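(* Let $k\ge 2$ and $1\le i\le k-1$. The maximal subgroups of $M_{k,i}$ (other than the trivial subgroup $\{\mathbf 0\}$) are isomorphic to the groups $G_{k,j}$ for $j=1,\dots,k-1$, where for each such $j$ the group $G_{k,j}$ is isomorphic to the maximal subgroups of the $\mathcal D$-class $$D_j=\{\varphi\in M_{k,i}:\ \varphi\ne\mathbf 0,\ |\mathsf{imC}(\varphi)|\equiv j \bmod (k-1)\}.$$ The same is true for $\mathit{Inv}_{k,i}$ in place of $M_{k,i}$ (with $D_j=\{\varphi\in \mathit{Inv}_{k,i}:\varphi\ne\mathbf 0,\ |\mathsf{imC}(\varphi)|\equiv j \bmod (k-1)\}$).
   Context: Let $A=\{a_1,\dots,a_k\}$ with $k\ge 2$ and $B=\{b_1,\dots,b_i\}$ with $i\ge 1$ be finite alphabets. $A^*$ is the set of all finite words over $A$ (including the empty word), and $BA^*$ is the set of words $b_jx$ with $b_j\in B$, $x\in A^*$. A right ideal of $BA^*$ is a subset $R\subseteq BA^*$ with $RA^*=R$ (the empty set is allowed). A prefix code in $BA^*$ is a set of words none of which is a proper prefix of another; every finitely generated right ideal equals $PA^*$ for a unique finite prefix code $P$. Two sets intersect iff their intersection is non-empty. A right ideal is essential iff it intersects every non-empty right ideal of $BA^*$. Two right ideals are essentially equal iff every right ideal of $BA^*$ that intersects one also intersects the other. A right ideal homomorphism over $BA^*$ is a total surjective function $\varphi:R_1\to R_2$ between finitely generated right ideals of $BA^*$ with $\varphi(rx)=\varphi(r)x$ for all $r\in R_1$, $x\in A^*$; $\mathsf{Im}(\varphi)=R_2$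 and $\mathsf{imC}(\varphi)$ is the finite prefix code with $\mathsf{Im}(\varphi)=\mathsf{imC}(\varphi)A^*$. Two right ideal homomorphisms are essentially equal iff their domains are essentially equal and they agree on the intersection of their domains. Every right ideal homomorphism $\varphi$ has a unique maximal essentially equal extension $\max(\varphi)$ to a right ideal homomorphism. A right ideal isomorphism is a bijective right ideal homomorphism whose domain and image are both essential. $M_{k,i}$ is the monoid of all maximally extended right ideal homomorphisms over $BA^*$, with product $\psi\varphi=\max(\psi\circ\varphi)$ ($\circ$ is composition of partial functions, $\varphi$ applied first). $\mathit{Inv}_{k,i}$ is the submonoid of all maximally extended bijective right ideal homomorphisms between (not necessarily essential) right ideals. $G_{k,i}$ is the group of all maximally extended right ideal isomorphisms, with the same multiplication. $\mathbf 0$ is the empty map. Green's relations in a monoid $M$: $u\le_{\mathcal L}v$ iff $u=xv$ for some $x\in M$; $u\le_{\mathcal R}v$ iff $u=vx$ for some $x\in M$; $\equiv_{\mathcal L},\equiv_{\mathcal R}$ are the associated equivalences; $u\equiv_{\mathcal D}v$ iff there is $s\in M$ with $u\equiv_{\mathcal R}s\equiv_{\mathcal L}v$. The sets $D_j$ ($1\le j\le k-1$) are the non-zero $\mathcal D$-classes of $M_{k,i}$ (respectively of $\mathit{Inv}_{k,i}$). A maximal subgroup of a semigroup is a subgroup (a subsemigroup that is a group, whose identity may be any idempotent) not strictly contained in another subgroup. *)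

theory Defs
  imports "HOL-Algebra.Group" "HOL-Library.Sublist" "HOL-Number_Theory.Cong"
begin

section \<open>Right ideals of \<open>BA\<^sup>*\<close>\<close>

text \<open>
  Words are lists over a common letter type, so \<open>A\<^sup>*\<close> is \<^term>\<open>lists A\<close>. The alphabets
  \<open>A\<close> and \<open>B\<close> may overlap: a word of \<open>BA\<^sup>*\<close> is determined by its head and its tail.
\<close>

definition BA_words :: "'a set \<Rightarrow> 'a set \<Rightarrow> 'a list set" where
  "BA_words A B = {b # x | b x. b \<in> B \<and> x \<in> lists A}"

definition right_mult :: "'a list set \<Rightarrow> 'a set \<Rightarrow> 'a list set" where
  "right_mult R A = {r @ x | r x. r \<in> R \<and> x \<in> lists A}"

definition right_ideal :: "'a set \<Rightarrow> 'a set \<Rightarrow> 'a list set \<Rightarrow> bool" where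
  "right_ideal A B R \<longleftrightarrow> R \<subseteq> BA_words A B \<and> right_mult R A = R"

definition fg_right_ideal :: "'a set \<Rightarrow> 'a set \<Rightarrow> 'a list set \<Rightarrow> bool" where
  "fg_right_ideal A B R \<longleftrightarrow>
     right_ideal A B R \<and> (\<exists>P. finite P \<and> P \<subseteq> BA_words A B \<and> R = right_mult P A)"

definition prefix_code :: "'a set \<Rightarrow> 'a set \<Rightarrow> 'a list set \<Rightarrow> bool" where
  "prefix_code A B P \<longleftrightarrow>
     P \<subseteq> BA_words A B \<and> (\<forall>p\<in>P. \<forall>q\<in>P. \<not> strict_prefix p q)"

definition essential :: "'a set \<Rightarrow> 'a set \<Rightarrow> 'a list set \<Rightarrow> bool" where
  "essential A B R \<longleftrightarrow>
     right_ideal A B R \<and> (\<forall>S. right_ideal A B S \<and> S \<noteq> {} \<longrightarrow> R \<inter> S \<noteq> {})"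

definition ess_eq_ideal :: "'a set \<Rightarrow> 'a set \<Rightarrow> 'a list set \<Rightarrow> 'a list set \<Rightarrow> bool" where
  "ess_eq_ideal A B R\<^sub>1 R\<^sub>2 \<longleftrightarrow>
     (\<forall>S. right_ideal A B S \<longrightarrow> (S \<inter> R\<^sub>1 \<noteq> {} \<longleftrightarrow> S \<inter> R\<^sub>2 \<noteq> {}))"

section \<open>Right ideal homomorphisms\<close>

text \<open>
  A function from \<open>R\<^sub>1\<close> onto \<open>R\<^sub>2\<close> is a partial function on words with domain \<open>R\<^sub>1\<close> and range
  \<open>R\<^sub>2\<close>; totality on \<open>R\<^sub>1\<close> and surjectivity are built into this representation.
\<close>

definition rihom :: "'a set \<Rightarrow> 'a set \<Rightarrow> ('a list \<rightharpoonup> 'a list) \<Rightarrow> bool" where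
  "rihom A B \<phi> \<longleftrightarrow>
     fg_right_ideal A B (dom \<phi>) \<and> fg_right_ideal A B (ran \<phi>) \<and>
     (\<forall>r\<in>dom \<phi>. \<forall>x\<in>lists A. \<phi> (r @ x) = Some (the (\<phi> r) @ x))"

definition imC :: "'a set \<Rightarrow> 'a set \<Rightarrow> ('a list \<rightharpoonup> 'a list) \<Rightarrow> 'a list set" where
  "imC A B \<phi> = (THE P. finite P \<and> prefix_code A B P \<and> ran \<phi> = right_mult P A)"

definition ess_eq :: "'a set \<Rightarrow> 'a set \<Rightarrow> ('a list \<rightharpoonup> 'a list) \<Rightarrow> ('a list \<rightharpoonup> 'a list) \<Rightarrow> bool"
  where
  "ess_eq A B \<phi> \<psi> \<longleftrightarrow>
     ess_eq_ideal A B (dom \<phi>) (dom \<psi>) \<and> (\<forall>w \<in> dom \<phi> \<inter> dom \<psi>. \<phi> w = \<psi> w)"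

definition ess_eq_extensions ::
    "'a set \<Rightarrow> 'a set \<Rightarrow> ('a list \<rightharpoonup> 'a list) \<Rightarrow> ('a list \<rightharpoonup> 'a list) set" where
  "ess_eq_extensions A B \<phi> = {\<psi>. rihom A B \<psi> \<and> ess_eq A B \<phi> \<psi> \<and> \<phi> \<subseteq>\<^sub>m \<psi>}"

definition max_ext :: "'a set \<Rightarrow> 'a set \<Rightarrow> ('a list \<rightharpoonup> 'a list) \<Rightarrow> ('a list \<rightharpoonup> 'a list)" where
  "max_ext A B \<phi> =
     (THE \<psi>. \<psi> \<in> ess_eq_extensions A B \<phi> \<and>
        (\<forall>\<chi> \<in> ess_eq_extensions A B \<phi>. \<psi> \<subseteq>\<^sub>m \<chi> \<longrightarrow> \<chi> = \<psi>))"

section \<open>The monoids \<open>M\<close> and \<open>Inv\<close> and the group \<open>G\<close>\<close>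

definition M_monoid :: "'a set \<Rightarrow> 'a set \<Rightarrow> ('a list \<rightharpoonup> 'a list) monoid" where
  "M_monoid A B =
     \<lparr>carrier = {\<phi>. rihom A B \<phi> \<and> max_ext A B \<phi> = \<phi>},
      monoid.mult = (\<lambda>\<psi> \<phi>. max_ext A B (\<psi> \<circ>\<^sub>m \<phi>)),
      one = (\<lambda>w. if w \<in> BA_words A B then Some w else None)\<rparr>"

definition Inv_monoid :: "'a set \<Rightarrow> 'a set \<Rightarrow> ('a list \<rightharpoonup> 'a list) monoid" where
  "Inv_monoid A B =
     (M_monoid A B)\<lparr>carrier := {\<phi> \<in> carrier (M_monoid A B). inj_on \<phi> (dom \<phi>)}\<rparr>"

definition riiso :: "'a set \<Rightarrow> 'a set \<Rightarrow> ('a list \<rightharpoonup> 'a list) \<Rightarrow> bool" where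
  "riiso A B \<phi> \<longleftrightarrow>
     rihom A B \<phi> \<and> inj_on \<phi> (dom \<phi>) \<and> essential A B (dom \<phi>) \<and> essential A B (ran \<phi>)"

definition G_group :: "'a set \<Rightarrow> 'a set \<Rightarrow> ('a list \<rightharpoonup> 'a list) monoid" where
  "G_group A B =
     (M_monoid A B)\<lparr>carrier := {\<phi> \<in> carrier (M_monoid A B). riiso A B \<phi>}\<rparr>"

section \<open>Green's relations and maximal subgroups\<close>

definition green_leL :: "('m, 'r) monoid_scheme \<Rightarrow> 'm \<Rightarrow> 'm \<Rightarrow> bool" where
  "green_leL M u v \<longleftrightarrow> (\<exists>x \<in> carrier M. u = x \<otimes>\<^bsub>M\<^esub> v)"

definition green_leR :: "('m, 'r) monoid_scheme \<Rightarrow> 'm \<Rightarrow> 'm \<Rightarrow> bool" where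
  "green_leR M u v \<longleftrightarrow> (\<exists>x \<in> carrier M. u = v \<otimes>\<^bsub>M\<^esub> x)"

definition green_eqL :: "('m, 'r) monoid_scheme \<Rightarrow> 'm \<Rightarrow> 'm \<Rightarrow> bool" where
  "green_eqL M u v \<longleftrightarrow> green_leL M u v \<and> green_leL M v u"

definition green_eqR :: "('m, 'r) monoid_scheme \<Rightarrow> 'm \<Rightarrow> 'm \<Rightarrow> bool" where
  "green_eqR M u v \<longleftrightarrow> green_leR M u v \<and> green_leR M v u"

definition green_D :: "('m, 'r) monoid_scheme \<Rightarrow> ('m \<times> 'm) set" where
  "green_D M = {(u, v). u \<in> carrier M \<and> v \<in> carrier M \<and>
                        (\<exists>s \<in> carrier M. green_eqR M u s \<and> green_eqL M s v)}"

definition D_classes :: "('m, 'r) monoid_scheme \<Rightarrow> 'm set set" where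
  "D_classes M = carrier M // green_D M"

text \<open>
  Unlike for \<^const>\<open>subgroup\<close>, the identity \<open>e\<close> need not be the identity of \<open>M\<close>.
\<close>

definition semigroup_subgroup :: "('m, 'r) monoid_scheme \<Rightarrow> 'm set \<Rightarrow> bool" where
  "semigroup_subgroup M H \<longleftrightarrow>
     H \<subseteq> carrier M \<and> (\<exists>e\<in>H. group (M\<lparr>carrier := H, one := e\<rparr>))"

definition maximal_subgroup :: "('m, 'r) monoid_scheme \<Rightarrow> 'm set \<Rightarrow> bool" where
  "maximal_subgroup M H \<longleftrightarrow>
     semigroup_subgroup M H \<and> (\<forall>K. semigroup_subgroup M K \<longrightarrow> \<not> H \<subset> K)"

definition D_set ::
    "'a set \<Rightarrow> 'a set \<Rightarrow> ('a list \<rightharpoonup> 'a list) monoid \<Rightarrow> nat \<Rightarrow> ('a list \<rightharpoonup> 'a list) set" where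
  "D_set A B M j =
     {\<phi> \<in> carrier M. \<phi> \<noteq> Map.empty \<and> [card (imC A B \<phi>) = j] (mod (card A - 1))}"

end

theory Submission
  imports Defs "HOL-Library.Stream"
begin

text \<open>
  A right ideal homomorphism \<open>\<phi>\<close> acts on infinite words by \<open>wz \<mapsto> \<phi>(w)z\<close>. Because \<open>A\<close> has at least
  two letters, essentially equal homomorphisms are exactly those that induce the same partial map on
  infinite words, and the maximal extension can be read off from that map. So \<open>M\<close>, \<open>Inv\<close> and \<open>G\<close>
  become semigroups of relations under relational composition, and associativity is free.

  There, \<open>\<equiv>\<^sub>R\<close> means equality of the images, since every prefix replacement map has a section over
  its image, and \<open>\<equiv>\<^sub>D\<close> means that some bijective prefix replacement map carries one image to the
  other. Splitting a word \<open>p\<close> of a prefix code into the words \<open>pa\<close>, \<open>a \<in> A\<close>, adds \<open>k - 1\<close> words, so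
  such a bijection exists as soon as the code sizes agree modulo \<open>k - 1\<close>; conversely the number of
  words of a large length \<open>N\<close> in \<open>PA\<^sup>*\<close> is congruent to \<open>|P|\<close>. A maximal subgroup is the group of units
  of \<open>eMe\<close> for an idempotent \<open>e\<close>. It acts faithfully on the image of \<open>e\<close> by all bijections, and
  conjugating by a bijection \<open>S\<close> from the image of \<open>e\<close> onto \<open>CA\<^sup>\<omega>\<close>, \<open>|C| = j\<close>, identifies it with
  \<open>G_group A C\<close>.
\<close>

section \<open>Words, cylinders and prefix replacement\<close>

lemma shift_eq_shiftD:
  assumes "u @- y = v @- z"
  shows "(\<exists>t. v = u @ t \<and> y = t @- z) \<or> (\<exists>t. u = v @ t \<and> z = t @- y)"
  using assms
proof (induction u arbitrary: v)
  case (Cons a u)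
  then show ?case by (cases v) auto
qed simp

lemma shift_in_streams_iff: "w @- z \<in> streams A \<longleftrightarrow> set w \<subseteq> A \<and> z \<in> streams A"
  by (auto simp: streams_iff_sset)

lemma BA_words_iff: "w \<in> BA_words A B \<longleftrightarrow> w \<noteq> [] \<and> hd w \<in> B \<and> set (tl w) \<subseteq> A"
  by (cases w) (auto simp: BA_words_def)

lemma BA_words_mono: "B \<subseteq> C \<Longrightarrow> BA_words A B \<subseteq> BA_words A C"
  by (auto simp: BA_words_def)

text \<open>Only the first letter depends on the head alphabet, so \<open>C\<close> may differ from
  \<open>B\<close>. Mostly used to see that what is left of one word after removing another has all
  its letters in \<open>A\<close>.\<close>

lemma BA_words_append:
  assumes "w \<in> BA_words A B"
  shows "w @ x \<in> BA_words A C \<longleftrightarrow> hd w \<in> C \<and> set x \<subseteq> A"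
  using assms by (cases w) (auto simp: BA_words_iff)

text \<open>For \<open>P \<subseteq> BA_words A B\<close> this is the prefix code that generates the
  same right ideal as \<open>P\<close>.\<close>

definition min_words :: "'a list set \<Rightarrow> 'a list set" where
  "min_words P = {p \<in> P. \<forall>q\<in>P. \<not> strict_prefix q p}"

lemma min_words_prefix:
  assumes "p \<in> P"
  shows "\<exists>q\<in>min_words P. prefix q p"
  using assms
proof (induction p rule: measure_induct_rule[where f = length])
  case (less p)
  show ?case
  proof (cases "p \<in> min_words P")
    case False
    then obtain q where "q \<in> P" "strict_prefix q p"
      using less.prems by (auto simp: min_words_def)
    with less.IH[of q] show ?thesis
      by (meson prefix_length_less prefix_order.trans strict_prefix_def)
  qed auto
qed

lemma min_words_subset: "min_words P \<subseteq> P"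
  by (auto simp: min_words_def)

lemma prefix_code_min_words: "P \<subseteq> BA_words A B \<Longrightarrow> prefix_code A B (min_words P)"
  by (auto simp: prefix_code_def min_words_def)

lemma prefix_codeD: "prefix_code A B P \<Longrightarrow> p \<in> P \<Longrightarrow> p @ t \<in> P \<Longrightarrow> t = []"
  unfolding prefix_code_def strict_prefix_def prefix_def
  by (metis append_self_conv)

section \<open>Cylinders and prefix replacement maps\<close>

definition cyl :: "'a set \<Rightarrow> 'a list set \<Rightarrow> 'a stream set" where
  "cyl A P = {p @- z | p z. p \<in> P \<and> z \<in> streams A}"

text \<open>The table \<open>T\<close> is a relation and not a function, so that the converse is
  again of this form and left-hand words may be comparable.\<close>

definition replace_prefix :: "'a set \<Rightarrow> ('a list \<times> 'a list) set \<Rightarrow> ('a stream \<times> 'a stream) set" where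
  "replace_prefix A T = {(p @- z, q @- z) | p q z. (p, q) \<in> T \<and> z \<in> streams A}"

text \<open>Single-valuedness is demanded of the action, since a table with comparable left-hand
  words may or may not act consistently. Head letters are unrestricted, so that maps from words
  headed in \<open>B\<close> to words headed in another alphabet \<open>C\<close> belong to the same
  class.\<close>

definition prefix_maps :: "'a set \<Rightarrow> ('a stream \<times> 'a stream) set set" where
  "prefix_maps A = {replace_prefix A T | T. finite T \<and> T \<subseteq> BA_words A UNIV \<times> BA_words A UNIV \<and>
                                single_valued (replace_prefix A T)}"

lemma cylI: "p \<in> P \<Longrightarrow> z \<in> streams A \<Longrightarrow> p @- z \<in> cyl A P"
  by (auto simp: cyl_def)

lemma cyl_mono: "P \<subseteq> Q \<Longrightarrow> cyl A P \<subseteq> cyl A Q"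
  by (auto simp: cyl_def)

lemma replace_prefixI: "(p, q) \<in> T \<Longrightarrow> z \<in> streams A \<Longrightarrow> (p @- z, q @- z) \<in> replace_prefix A T"
  by (auto simp: replace_prefix_def)

lemma converse_replace_prefix: "(replace_prefix A T)\<inverse> = replace_prefix A (T\<inverse>)"
  by (auto simp: replace_prefix_def)

lemma Domain_replace_prefix: "Domain (replace_prefix A T) = cyl A (fst ` T)"
proof -
  have "s \<in> Domain (replace_prefix A T) \<longleftrightarrow> s \<in> cyl A (fst ` T)" for s
    unfolding replace_prefix_def cyl_def image_iff Domain_iff mem_Collect_eq
    by (metis fst_conv prod.collapse prod.inject)
  then show ?thesis by blast
qed

lemma Range_replace_prefix: "Range (replace_prefix A T) = cyl A (snd ` T)"
proof -
  have "cyl A (snd ` T) = Domain ((replace_prefix A T)\<inverse>)"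
    unfolding converse_replace_prefix Domain_replace_prefix
    by (rule arg_cong[where f = "cyl A"]) force
  then show ?thesis by simp
qed

lemma cyl_min_words:
  assumes "P \<subseteq> BA_words A B"
  shows "cyl A (min_words P) = cyl A P"
proof
  show "cyl A (min_words P) \<subseteq> cyl A P"
    using min_words_subset by (fastforce simp: cyl_def)
  show "cyl A P \<subseteq> cyl A (min_words P)"
  proof
    fix s assume "s \<in> cyl A P"
    then obtain p z where s: "s = p @- z" "p \<in> P" "z \<in> streams A" by (auto simp: cyl_def)
    then obtain q t where q: "q \<in> min_words P" "p = q @ t"
      using min_words_prefix[of p P] by (auto simp: prefix_def)
    have "q @ t \<in> BA_words A B" "q \<in> BA_words A B" using q s assms min_words_subset by blast+
    then have "set t \<subseteq> A" using BA_words_append by blast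
    then have "t @- z \<in> streams A" using s by (simp add: shift_in_streams_iff)
    then show "s \<in> cyl A (min_words P)" using cylI[OF q(1)] s q by simp
  qed
qed

text \<open>An infinite word has at most one prefix in a prefix code, so it determines which
  left-hand word applies.\<close>

lemma single_valued_replace_prefix:
  assumes "prefix_code A B (fst ` T)" "single_valued T"
  shows "single_valued (replace_prefix A T)"
proof (rule single_valuedI)
  fix x y y' assume "(x, y) \<in> replace_prefix A T" "(x, y') \<in> replace_prefix A T"
  then obtain p q z p' q' z' where *: "x = p @- z" "y = q @- z" "(p,q) \<in> T" 
    "x = p' @- z'" "y' = q' @- z'" "(p',q') \<in> T"
    unfolding replace_prefix_def by blast
  have in_code: "p \<in> fst ` T" "p' \<in> fst ` T" using *(3,6) by force+
  have "(\<exists>t. p' = p @ t) \<or> (\<exists>t. p = p' @ t)" using shift_eq_shiftD[of p z p' z'] * by auto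
  then have "p' = p"
    using in_code prefix_codeD[OF assms(1)] by (metis append_Nil2)
  with * show "y = y'" using assms(2) by (auto dest: single_valuedD)
qed

lemma replace_prefix_in_prefix_maps:
  "finite T \<Longrightarrow> T \<subseteq> BA_words A UNIV \<times> BA_words A UNIV \<Longrightarrow> single_valued (replace_prefix A T) \<Longrightarrow>
   replace_prefix A T \<in> prefix_maps A"
  by (auto simp: prefix_maps_def)

lemma prefix_mapsE:
  assumes "R \<in> prefix_maps A"
  obtains T where "finite T" "T \<subseteq> BA_words A UNIV \<times> BA_words A UNIV"
    "R = replace_prefix A T" "single_valued R"
  using assms by (auto simp: prefix_maps_def)

lemma prefix_maps_single_valued: "R \<in> prefix_maps A \<Longrightarrow> single_valued R"
  by (auto simp: prefix_maps_def)

section \<open>Converses, composites and sections of prefix maps\<close>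

lemma prefix_maps_converse:
  assumes "R \<in> prefix_maps A" "single_valued (R\<inverse>)"
  shows "R\<inverse> \<in> prefix_maps A"
proof -
  obtain T where T: "finite T" "T \<subseteq> BA_words A UNIV \<times> BA_words A UNIV" "R = replace_prefix A T"
    using assms(1) by (rule prefix_mapsE)
  then show ?thesis using assms(2)
    by (auto simp: converse_replace_prefix intro!: replace_prefix_in_prefix_maps)
qed

lemma Id_on_cyl: "Id_on (cyl A P) = replace_prefix A (Id_on P)"
  by (auto simp: cyl_def replace_prefix_def)

lemma Id_on_in_prefix_maps:
  "finite P \<Longrightarrow> P \<subseteq> BA_words A UNIV \<Longrightarrow> Id_on (cyl A P) \<in> prefix_maps A"
  unfolding Id_on_cyl
  by (rule replace_prefix_in_prefix_maps)
    (auto intro: finite_subset[OF Id_on_subset_Times] simp flip: Id_on_cyl)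

text \<open>The middle word of a composite is both \<open>q @- z\<close> and
  \<open>p' @- z'\<close>, so \<open>q\<close> and \<open>p'\<close> are comparable. The entry with
  the shorter middle word is lengthened by the difference \<open>t\<close>, and then the two entries
  are joined.\<close>

lemma replace_prefix_relcomp:
  fixes T U :: "('a list \<times> 'a list) set"
  assumes "T \<subseteq> BA_words A UNIV \<times> BA_words A UNIV" "U \<subseteq> BA_words A UNIV \<times> BA_words A UNIV"
    and "finite T" "finite U"
  shows "\<exists>V. finite V \<and> V \<subseteq> BA_words A UNIV \<times> BA_words A UNIV \<and>
    replace_prefix A T O replace_prefix A U = replace_prefix A V"
proof -
  define V where "V =
    {(p, q' @ t) | p q p' q' t. (p, q) \<in> T \<and> (p', q') \<in> U \<and> q = p' @ t} \<union>
    {(p @ t, q') | p q p' q' t. (p, q) \<in> T \<and> (p', q') \<in> U \<and> p' = q @ t}"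
  \<comment> \<open>The difference \<open>t\<close> is determined by the two entries, so each pair
    of entries contributes at most two elements to \<open>V\<close>.\<close>
  have "V \<subseteq> (\<lambda>((p, q), (p', q')). (p, q' @ drop (length p') q)) ` (T \<times> U) \<union>
             (\<lambda>((p, q), (p', q')). (p @ drop (length q) p', q')) ` (T \<times> U)"
    unfolding V_def by (force simp: image_iff)
  then have fin: "finite V" using assms(3,4) finite_subset by blast
  have t: "set t \<subseteq> A" if "u \<in> BA_words A UNIV" "u @ t \<in> BA_words A UNIV" for u t
    using that BA_words_append by blast
  have sub: "V \<subseteq> BA_words A UNIV \<times> BA_words A UNIV"
  proof
    fix w assume "w \<in> V"
    then obtain p q p' q' t where "(p, q) \<in> T" "(p', q') \<in> U"
      "w = (p, q' @ t) \<and> q = p' @ t \<or> w = (p @ t, q') \<and> p' = q @ t"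
      unfolding V_def by blast
    moreover from this have "p \<in> BA_words A UNIV" "q \<in> BA_words A UNIV" "p' \<in> BA_words A UNIV"
      "q' \<in> BA_words A UNIV"
      using assms(1,2) by blast+
    ultimately show "w \<in> BA_words A UNIV \<times> BA_words A UNIV"
      by (auto simp: BA_words_append)
  qed
  have "replace_prefix A T O replace_prefix A U \<subseteq> replace_prefix A V"
  proof (rule subrelI)
    fix x y assume "(x, y) \<in> replace_prefix A T O replace_prefix A U"
    then obtain p q z p' q' z' where *: "x = p @- z" "q @- z = p' @- z'" "y = q' @- z'" 
      "(p, q) \<in> T" "(p', q') \<in> U" "z \<in> streams A" "z' \<in> streams A"
      unfolding replace_prefix_def by blast
    from shift_eq_shiftD[OF *(2)] show "(x, y) \<in> replace_prefix A V"
    proof (elim disjE exE conjE)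
      fix t assume "p' = q @ t" "z = t @- z'"
      then have "(p @ t, q') \<in> V" using * unfolding V_def by blast
      then show ?thesis using replace_prefixI[of "p @ t" q' V z' A] * \<open>z = _\<close> by simp
    next
      fix t assume "q = p' @ t" "z' = t @- z"
      then have "(p, q' @ t) \<in> V" using * unfolding V_def by blast
      then show ?thesis using replace_prefixI[of p "q' @ t" V z A] * \<open>z' = _\<close> by simp
    qed
  qed
  moreover have "replace_prefix A V \<subseteq> replace_prefix A T O replace_prefix A U"
  proof (rule subrelI)
    fix x y assume "(x, y) \<in> replace_prefix A V"
    then obtain u v z where *: "x = u @- z" "y = v @- z" "(u, v) \<in> V" "z \<in> streams A"
      unfolding replace_prefix_def by blast
    from *(3) consider
      p q p' q' t where "u = p" "v = q' @ t" "(p, q) \<in> T" "(p', q') \<in> U" "q = p' @ t"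
      | p q p' q' t where "u = p @ t" "v = q'" "(p, q) \<in> T" "(p', q') \<in> U" "p' = q @ t"
      unfolding V_def by blast
    then show "(x, y) \<in> replace_prefix A T O replace_prefix A U"
    proof cases
      case 1
      then have "t @- z \<in> streams A"
        using assms *(4) t[of p' t] by (auto simp: shift_in_streams_iff)
      then have "((q @- z), q' @- t @- z) \<in> replace_prefix A U"
        using 1 replace_prefixI[of p' q' U "t @- z" A] by simp
      then show ?thesis using 1 * replace_prefixI[of p q T z A] by auto
    next
      case 2
      then have "t @- z \<in> streams A"
        using assms *(4) t[of q t] by (auto simp: shift_in_streams_iff)
      then have "((p @- t @- z), q @- t @- z) \<in> replace_prefix A T"
        using 2 replace_prefixI[of p q T "t @- z" A] by simp
      then show ?thesis using 2 * replace_prefixI[of p' q' U z A] by auto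
    qed
  qed
  ultimately show ?thesis using fin sub by blast
qed

lemma prefix_maps_relcomp:
  assumes "R \<in> prefix_maps A" "S \<in> prefix_maps A"
  shows "R O S \<in> prefix_maps A"
proof -
  obtain T where T: "finite T" "T \<subseteq> BA_words A UNIV \<times> BA_words A UNIV" "R = replace_prefix A T"
    "single_valued R"
    using assms(1) by (rule prefix_mapsE)
  obtain U where U: "finite U" "U \<subseteq> BA_words A UNIV \<times> BA_words A UNIV" "S = replace_prefix A U"
    "single_valued S"
    using assms(2) by (rule prefix_mapsE)
  have sv: "single_valued (R O S)" using T(4) U(4) by (rule single_valued_relcomp)
  obtain V where "finite V" "V \<subseteq> BA_words A UNIV \<times> BA_words A UNIV" "R O S = replace_prefix A V"
    using replace_prefix_relcomp[OF T(2) U(2) T(1) U(1)] T U by metis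
  with sv show ?thesis by (auto intro!: replace_prefix_in_prefix_maps)
qed

text \<open>Each word of a prefix code for the image is sent back to one chosen partner; the code
  property makes this single-valued. The section is injective, hence also available in the monoid of
  injective maps.\<close>

lemma prefix_maps_section:
  assumes "R \<in> prefix_maps A"
  shows "\<exists>S \<in> prefix_maps A. S O R = Id_on (Range R) \<and> Range S \<subseteq> Domain R \<and>
            Domain S = Range R \<and> single_valued (S\<inverse>)"
proof -
  obtain T where T: "finite T" "T \<subseteq> BA_words A UNIV \<times> BA_words A UNIV" "R = replace_prefix A T"
    "single_valued R"
    using assms(1) by (rule prefix_mapsE)
  define Q where "Q = min_words (snd ` T)"
  have sub: "snd ` T \<subseteq> BA_words A UNIV" using T by auto
  have Q: "finite Q" "cyl A Q = Range R" "prefix_code A UNIV Q"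
    using cyl_min_words[OF sub] prefix_code_min_words[OF sub] T
    by (auto simp: Q_def Range_replace_prefix min_words_def)
  have "\<forall>q\<in>Q. \<exists>p. (p, q) \<in> T" by (auto simp: Q_def min_words_def)
  then obtain f where f: "\<And>q. q \<in> Q \<Longrightarrow> (f q, q) \<in> T" by metis
  define S where "S = replace_prefix A ((\<lambda>q. (q, f q)) ` Q)"
  have fst: "fst ` ((\<lambda>q. (q, f q)) ` Q) = Q" by force
  have "single_valued S" unfolding S_def
    by (rule single_valued_replace_prefix[where B = UNIV]) (auto simp: fst Q single_valued_def)
  then have S: "S \<in> prefix_maps A" using Q(1) f T(2)
    unfolding S_def by (intro replace_prefix_in_prefix_maps) auto
  have dom: "Domain S = Range R"
    unfolding S_def Domain_replace_prefix fst Q ..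
  \<comment> \<open>Since \<open>R\<close> is single-valued, this inclusion gives injectivity of
    \<open>S\<close>, and together with the full domain it gives
    \<open>S O R = Id_on (Range R)\<close>.\<close>
  have SR: "S \<subseteq> R\<inverse>" unfolding S_def T(3) using f by (auto simp: replace_prefix_def)
  have "S O R = Id_on (Range R)"
    using SR dom T(4) unfolding single_valued_def by fast
  moreover have "single_valued (S\<inverse>)" using SR T(4) unfolding single_valued_def by fast
  ultimately show ?thesis using S dom SR by blast
qed

section \<open>Counting prefix codes\<close>

locale alphabet =
  fixes A :: "'a set"
  assumes finite_A: "finite A" and card_A: "2 \<le> card A"
begin

lemma streams_nonempty: "\<exists>z. z \<in> streams A"
proof -
  have "A \<noteq> {}" using card_A by auto
  then show ?thesis using streams_empty_iff by blast
qed

text \<open>This is where two letters matter. One of \<open>u\<close>, \<open>v\<close> extends the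
  other by some \<open>t\<close>, so \<open>t @- z = z\<close> for all \<open>z\<close>; a constant
  infinite word in a letter other than the first of \<open>t\<close> refutes this unless
  \<open>t\<close> is empty.\<close>

lemma shift_ext:
  assumes "\<And>z. z \<in> streams A \<Longrightarrow> u @- z = v @- z"
  shows "u = v"
proof -
  have *: "t = []" if "\<And>z. z \<in> streams A \<Longrightarrow> t @- z = z" for t
  proof (rule ccontr)
    assume "t \<noteq> []"
    then obtain c t' where t: "t = c # t'" by (cases t) auto
    obtain a where a: "a \<in> A" "a \<noteq> c"
    proof -
      have "\<not> A \<subseteq> {c}" using card_A card_mono[of "{c}" A] by auto
      then show thesis using that by blast
    qed
    have "shd (t @- sconst a) = a" using that[of "sconst a"] a by (simp add: sconst_streams)
    then show False using a t by simp
  qed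
  obtain z where z: "z \<in> streams A" using streams_nonempty by blast
  from shift_eq_shiftD[OF assms[OF z]] show ?thesis
  proof (elim disjE exE conjE)
    fix t assume "v = u @ t"
    then show ?thesis using *[of t] assms by (metis append_Nil2 shift_append shift_left_inj)
  next
    fix t assume "u = v @ t"
    then show ?thesis using *[of t] assms by (metis append_Nil2 shift_append shift_left_inj)
  qed
qed

text \<open>The entries with minimal left-hand words already cover the whole domain, and a
  single-valued relation equals any part of it with the same domain.\<close>

lemma prefix_maps_code_domain:
  assumes "R \<in> prefix_maps A"
  shows "\<exists>T. finite T \<and> T \<subseteq> BA_words A UNIV \<times> BA_words A UNIV \<and> R = replace_prefix A T \<and>
             prefix_code A UNIV (fst ` T) \<and> single_valued T"
proof -
  obtain U where U: "finite U" "U \<subseteq> BA_words A UNIV \<times> BA_words A UNIV" "R = replace_prefix A U"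
    "single_valued R"
    using assms(1) by (rule prefix_mapsE)
  define T where "T = {(p, q) \<in> U. p \<in> min_words (fst ` U)}"
  have fst: "fst ` T = min_words (fst ` U)" by (force simp: T_def min_words_def)
  have TU: "T \<subseteq> U" by (auto simp: T_def)
  have subU: "fst ` U \<subseteq> BA_words A UNIV" using U(2) by auto
  have sub: "replace_prefix A T \<subseteq> R" using TU U(3) by (auto simp: replace_prefix_def)
  have "Domain (replace_prefix A T) = Domain R"
    unfolding U(3) Domain_replace_prefix fst using cyl_min_words[OF subU] .
  with sub U(4) have eq: "R = replace_prefix A T"
    unfolding single_valued_def by fast
  have "single_valued T"
  proof (rule single_valuedI)
    fix p q q' assume "(p, q) \<in> T" "(p, q') \<in> T"
    then have "q @- z = q' @- z" if "z \<in> streams A" for z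
      using U(4) eq that by (blast intro: replace_prefixI dest: single_valuedD)
    then show "q = q'" by (rule shift_ext)
  qed
  moreover have "finite T" using TU U(1) by (rule finite_subset)
  moreover have "T \<subseteq> BA_words A UNIV \<times> BA_words A UNIV" using TU U(2) by (rule order_trans)
  moreover have "prefix_code A UNIV (fst ` T)" unfolding fst using subU by (rule prefix_code_min_words)
  ultimately show ?thesis using eq by blast
qed

section \<open>The size of a prefix code modulo \<open>card A - 1\<close>\<close>

lemma power_card_cong_1: "[card A ^ m = 1] (mod (card A - 1))"
proof -
  have "[1 + (card A - 1) = 1] (mod (card A - 1))"
    by (simp only: cong_add_lcancel_0_nat) (simp add: cong_def)
  then have "[card A = 1] (mod (card A - 1))" using card_A by simp
  then show ?thesis using cong_pow[of "card A" 1 "card A - 1" m] by simp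
qed

text \<open>The initial segments of length \<open>N\<close> split into one disjoint block per
  \<open>p\<close>, of size \<open>card A ^ (N - length p)\<close>, and \<open>card A\<close> is
  congruent to \<open>1\<close>. Thus the cylinder alone determines \<open>card P\<close> up to
  congruence.\<close>

lemma card_stake_cyl_cong:
  assumes "prefix_code A B P" "finite P" "\<And>p. p \<in> P \<Longrightarrow> length p \<le> N"
  shows "[card (stake N ` cyl A P) = card P] (mod (card A - 1))"
proof -
  define L where "L p = (@) p ` {x. set x \<subseteq> A \<and> length x = N - length p}" for p
  have "stake N ` cyl A P = (\<Union>p\<in>P. L p)"
  proof (intro equalityI subsetI)
    fix w assume "w \<in> stake N ` cyl A P"
    then obtain p z where p: "p \<in> P" "z \<in> streams A" "w = stake N (p @- z)" by (auto simp: cyl_def)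
    have "set (stake n z) \<subseteq> A" for n
      using p(2) stake_sdrop[of n z] shift_in_streams_iff[of "stake n z" "sdrop n z" A] by simp
    then have "w \<in> L p" using p assms(3)[of p] by (auto simp: L_def stake_shift)
    then show "w \<in> (\<Union>p\<in>P. L p)" using p(1) by blast
  next
    fix w assume "w \<in> (\<Union>p\<in>P. L p)"
    then obtain p x where p: "p \<in> P" "set x \<subseteq> A" "length x = N - length p" "w = p @ x"
      by (auto simp: L_def)
    obtain z where z: "z \<in> streams A" using streams_nonempty by blast
    have "stake N (p @- x @- z) = w"
      using p assms(3)[of p] by (simp add: stake_shift)
    moreover have "p @- x @- z \<in> cyl A P" using p z by (auto intro!: cylI simp: shift_in_streams_iff)
    ultimately show "w \<in> stake N ` cyl A P" by (metis imageI)
  qed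
  moreover have "card (\<Union>p\<in>P. L p) = (\<Sum>p\<in>P. card (L p))"
  proof (rule card_UN_disjoint)
    show "finite P" by fact
    show "\<forall>p\<in>P. finite (L p)" unfolding L_def using finite_A by (simp add: finite_lists_length_eq)
    show "\<forall>p\<in>P. \<forall>q\<in>P. p \<noteq> q \<longrightarrow> L p \<inter> L q = {}"
    proof (intro ballI impI)
      fix p q assume pq: "p \<in> P" "q \<in> P" "p \<noteq> q"
      show "L p \<inter> L q = {}"
      proof (rule ccontr)
        assume "L p \<inter> L q \<noteq> {}"
        then obtain x y where "p @ x = q @ y" by (auto simp: L_def)
        then have "(\<exists>t. q = p @ t) \<or> (\<exists>t. p = q @ t)" by (auto simp: append_eq_append_conv2)
        then show False using pq prefix_codeD[OF assms(1)] by (metis append_Nil2)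
      qed
    qed
  qed
  moreover have "card (L p) = card A ^ (N - length p)" for p
    unfolding L_def by (subst card_image) (auto simp: inj_on_def card_lists_length_eq finite_A)
  moreover have "[(\<Sum>p\<in>P. card A ^ (N - length p)) = (\<Sum>p\<in>P. 1)] (mod (card A - 1))"
    by (rule cong_sum) (rule power_card_cong_1)
  ultimately show ?thesis by simp
qed

lemma card_cong_of_cyl_eq:
  assumes "prefix_code A B P" "finite P" "prefix_code A C Q" "finite Q" "cyl A P = cyl A Q"
  shows "[card P = card Q] (mod (card A - 1))"
proof -
  \<comment> \<open>\<open>insert 0\<close> keeps \<open>Max\<close> meaningful when both codes are
    empty.\<close>
  define N where "N = Max (insert 0 (length ` (P \<union> Q)))"
  have N: "\<And>p. p \<in> P \<union> Q \<Longrightarrow> length p \<le> N" unfolding N_def using assms(2,4) by (intro Max_ge) auto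
  show ?thesis
    using card_stake_cyl_cong[OF assms(1,2), of N] card_stake_cyl_cong[OF assms(3,4), of N] N
    unfolding assms(5) by (metis UnCI cong_sym cong_trans)
qed

text \<open>One word \<open>p\<close> is split into its \<open>card A\<close> one-letter extensions,
  none of which lies in \<open>P\<close>.\<close>

lemma prefix_code_refine_step:
  assumes "prefix_code A B P" "finite P" "P \<noteq> {}"
  shows "\<exists>Q. prefix_code A B Q \<and> finite Q \<and> cyl A Q = cyl A P \<and> card Q = card P + (card A - 1)"
proof -
  obtain p where p: "p \<in> P" using assms(3) by blast
  define E where "E = (\<lambda>a. p @ [a]) ` A"
  define Q where "Q = (P - {p}) \<union> E"
  have no: "x \<notin> P" if "x \<in> E" for x
    using that p prefix_codeD[OF assms(1) p] by (auto simp: E_def)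
  have W: "P \<subseteq> BA_words A B" using assms(1) by (auto simp: prefix_code_def)
  have ac: "\<not> strict_prefix x y" if "x \<in> P" "y \<in> P" for x y
    using that assms(1) by (auto simp: prefix_code_def)
  have "prefix_code A B Q"
    unfolding prefix_code_def
  proof (intro conjI ballI)
    show "Q \<subseteq> BA_words A B"
      using W p by (auto simp: Q_def E_def BA_words_append BA_words_iff)
    fix x y assume "x \<in> Q" "y \<in> Q"
    then consider "x \<in> P" "y \<in> P" | a where "x \<in> P" "x \<noteq> p" "y = p @ [a]" 
      | a where "x = p @ [a]" "y \<in> P" | a b where "x = p @ [a]" "y = p @ [b]"
      by (auto simp: Q_def E_def)
    \<comment> \<open>A proper prefix of a child of \<open>p\<close> is a prefix of
      \<open>p\<close>, and a proper extension of a child properly extends \<open>p\<close>. Both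
      contradict the code property of \<open>P\<close>, the first because
      \<open>x \<noteq> p\<close>.\<close>
    then show "\<not> strict_prefix x y"
    proof cases
      case 2
      then show ?thesis using ac[OF _ p] by (auto simp: strict_prefix_def)
    next
      case 3
      then show ?thesis using ac[OF p] prefix_order.less_trans[of p "p @ [a]" y] by (auto simp: strict_prefix_def)
    qed (auto simp: ac dest: prefix_length_less)
  qed
  moreover have "finite Q" using assms(2) finite_A by (simp add: Q_def E_def)
  moreover have "card Q = card P + (card A - 1)"
  proof -
    have "card E = card A" unfolding E_def by (rule card_image) (simp add: inj_on_def)
    moreover have "card Q = card (P - {p}) + card E"
      unfolding Q_def using assms(2) finite_A no by (intro card_Un_disjoint) (auto simp: E_def)
    moreover have "card P > 0" using p assms(2) card_gt_0_iff by blast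
    ultimately show ?thesis using p card_A by (simp add: card_Diff_singleton)
  qed
  moreover have "cyl A Q = cyl A P"
  proof (intro equalityI subsetI)
    fix s assume "s \<in> cyl A Q"
    then obtain x z where x: "s = x @- z" "x \<in> Q" "z \<in> streams A" by (auto simp: cyl_def)
    then consider "x \<in> P" | a where "x = p @ [a]" "a \<in> A" by (auto simp: Q_def E_def)
    then show "s \<in> cyl A P"
    proof cases
      case 2
      then show ?thesis using x p cylI[of p P "a ## z" A] by auto
    qed (use x cylI in auto)
  next
    fix s assume "s \<in> cyl A P"
    then obtain x z where x: "s = x @- z" "x \<in> P" "z \<in> streams A" by (auto simp: cyl_def)
    show "s \<in> cyl A Q"
    proof (cases "x = p")
      case True
      obtain a z' where z: "z = a ## z'" "a \<in> A" "z' \<in> streams A"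
        using x(3) by (cases z) (auto simp: streams_Stream)
      then show ?thesis using cylI[of "p @ [a]" Q z' A] x True by (auto simp: Q_def E_def)
    next
      case False
      then show ?thesis using x cylI[of x Q] by (auto simp: Q_def)
    qed
  qed
  ultimately show ?thesis by blast
qed

lemma prefix_code_refine:
  assumes "prefix_code A B P" "finite P" "P \<noteq> {}"
  shows "\<exists>Q. prefix_code A B Q \<and> finite Q \<and> cyl A Q = cyl A P \<and> card Q = card P + m * (card A - 1)"
proof (induction m)
  case 0
  then show ?case using assms by auto
next
  case (Suc m)
  then obtain Q where Q: "prefix_code A B Q" "finite Q" "cyl A Q = cyl A P"
    "card Q = card P + m * (card A - 1)" by blast
  have "Q \<noteq> {}" using Q(2,4) assms by (auto simp: card_eq_0_iff)
  from prefix_code_refine_step[OF Q(1,2) this] Q(3,4) show ?case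
    by (metis add.assoc add.commute mult_Suc)
qed

section \<open>Bijections between the cylinders of two codes\<close>

lemma prefix_maps_bijection_of_card_eq:
  assumes "prefix_code A UNIV P" "finite P" "prefix_code A UNIV Q" "finite Q" "card P = card Q"
  shows "\<exists>S\<in>prefix_maps A. single_valued (S\<inverse>) \<and> Domain S = cyl A P \<and> Range S = cyl A Q"
proof -
  obtain h where h: "bij_betw h P Q"
    using assms(2,4,5) finite_same_card_bij by blast
  define T where "T = (\<lambda>p. (p, h p)) ` P"
  have T: "fst ` T = P" "snd ` T = Q" using h by (force simp: T_def bij_betw_def)+
  have sv: "single_valued T" "single_valued (T\<inverse>)"
    using h by (auto simp: T_def single_valued_def bij_betw_def inj_on_def)
  have fst': "fst ` (T\<inverse>) = Q" using T(2) by force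
  have "single_valued (replace_prefix A T)"
    by (rule single_valued_replace_prefix[where B = UNIV, OF _ sv(1)]) (simp add: T assms)
  then have "replace_prefix A T \<in> prefix_maps A"
    using assms bij_betwE[OF h]
    by (intro replace_prefix_in_prefix_maps) (auto simp: T_def prefix_code_def)
  moreover have "single_valued ((replace_prefix A T)\<inverse>)"
    unfolding converse_replace_prefix
    by (rule single_valued_replace_prefix[where B = UNIV, OF _ sv(2)]) (simp add: fst' assms)
  ultimately show ?thesis
    by (intro bexI[of _ "replace_prefix A T"]) (auto simp: Domain_replace_prefix Range_replace_prefix T)
qed

text \<open>Congruent sizes become equal after suitably many splittings on each side; non-emptiness
  provides a word to split.\<close>

lemma prefix_maps_bijection_of_card_cong:
  assumes P: "prefix_code A UNIV P" "finite P" "P \<noteq> {}"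
    and Q: "prefix_code A UNIV Q" "finite Q" "Q \<noteq> {}"
    and "[card P = card Q] (mod (card A - 1))"
  shows "\<exists>S\<in>prefix_maps A. single_valued (S\<inverse>) \<and> Domain S = cyl A P \<and> Range S = cyl A Q"
proof -
  obtain m n where "card P + m * (card A - 1) = card Q + n * (card A - 1)"
    using assms(7) unfolding cong_iff_lin_nat by metis
  then show ?thesis
    using prefix_code_refine[OF P, of m] prefix_code_refine[OF Q, of n]
      prefix_maps_bijection_of_card_eq by metis
qed

text \<open>Once the left-hand words of the table form a prefix code, injectivity makes the
  right-hand words a prefix code too. The table then matches two codes of equal size, and each has
  the same cylinder as \<open>P\<close> or \<open>Q\<close>.\<close>

lemma prefix_maps_bijection_card_cong:
  assumes S: "S \<in> prefix_maps A" "single_valued (S\<inverse>)" "Domain S = cyl A P" "Range S = cyl A Q"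
    and P: "prefix_code A UNIV P" "finite P" and Q: "prefix_code A UNIV Q" "finite Q"
  shows "[card P = card Q] (mod (card A - 1))"
proof -
  obtain T where T: "finite T" "T \<subseteq> BA_words A UNIV \<times> BA_words A UNIV" "S = replace_prefix A T"
    "prefix_code A UNIV (fst ` T)" "single_valued T"
    using prefix_maps_code_domain[OF S(1)] by blast
  \<comment> \<open>If one output extends another by \<open>t\<close>, the inputs
    \<open>p @ t\<close> and \<open>p'\<close> agree on every tail. The case \<open>t = []\<close>
    shows that distinct entries have distinct outputs.\<close>
  have *: "t = [] \<and> p = p'" if pq: "(p, q) \<in> T" "(p', q @ t) \<in> T" for p q p' t
  proof -
    have "q \<in> BA_words A UNIV" "q @ t \<in> BA_words A UNIV" using pq T(2) by blast+
    then have t: "set t \<subseteq> A" using BA_words_append by blast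
    have "(p @ t) @- z = p' @- z" if z: "z \<in> streams A" for z
    proof -
      have "(p @- t @- z, q @- t @- z) \<in> S" "(p' @- z, (q @ t) @- z) \<in> S"
        unfolding T(3) using pq t z replace_prefixI[OF pq(2), of z A] replace_prefixI[OF pq(1), of "t @- z" A]
        by (auto intro: replace_prefixI simp: shift_in_streams_iff)
      then show ?thesis using S(2) by (auto simp: single_valued_def)
    qed
    then have "p @ t = p'" by (rule shift_ext)
    moreover have "p \<in> fst ` T" "p' \<in> fst ` T" using pq by force+
    ultimately show ?thesis using prefix_codeD[OF T(4)] by auto
  qed
  have "prefix_code A UNIV (snd ` T)"
    unfolding prefix_code_def
  proof (intro conjI ballI notI)
    show "snd ` T \<subseteq> BA_words A UNIV" using T(2) by auto
    fix x y assume "x \<in> snd ` T" "y \<in> snd ` T" and xy: "strict_prefix x y"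
    then obtain p p' where "(p, x) \<in> T" "(p', y) \<in> T" by auto
    moreover obtain t where "y = x @ t" "t \<noteq> []"
      using xy by (auto simp: strict_prefix_def prefix_def)
    ultimately show False using * by blast
  qed
  then have "[card (snd ` T) = card Q] (mod (card A - 1))"
    using card_cong_of_cyl_eq[OF _ _ Q] S(4) T by (simp add: Range_replace_prefix)
  moreover have "[card (fst ` T) = card P] (mod (card A - 1))"
    using card_cong_of_cyl_eq[OF T(4) _ P] S(3) T by (simp add: Domain_replace_prefix)
  moreover have "card (fst ` T) = card T"
    using T(5) by (intro card_image) (auto simp: inj_on_def single_valued_def)
  moreover have "card (snd ` T) = card T"
    using *[of _ _ _ "[]"] by (intro card_image) (auto simp: inj_on_def)
  ultimately show ?thesis by (metis cong_sym cong_trans)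
qed

end

section \<open>Right ideal homomorphisms as maps on infinite words\<close>

context alphabet
begin

definition ends :: "('a list \<rightharpoonup> 'a list) \<Rightarrow> ('a stream \<times> 'a stream) set" where
  "ends \<phi> = replace_prefix A {(w, v). \<phi> w = Some v}"

text \<open>
  The value \<open>v\<close> has to be required to lie in \<open>BA\<^sup>*\<close>: if \<open>A \<subseteq> B\<close>, the empty word may satisfy the last
  condition.
\<close>
definition induces :: "'a set \<Rightarrow> ('a stream \<times> 'a stream) set \<Rightarrow> 'a list \<Rightarrow> 'a list \<Rightarrow> bool" where
  "induces B R w v \<longleftrightarrow>
     w \<in> BA_words A B \<and> v \<in> BA_words A B \<and> (\<forall>z\<in>streams A. (w @- z, v @- z) \<in> R)"

text \<open>An inverse of \<open>ends\<close>: the largest equivariant map on words with action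
  \<open>R\<close>. For single-valued \<open>R\<close> at most one \<open>v\<close> qualifies, by
  \<open>shift_ext\<close>, so \<open>SOME\<close> involves no real choice.\<close>

definition word_map :: "'a set \<Rightarrow> ('a stream \<times> 'a stream) set \<Rightarrow> 'a list \<rightharpoonup> 'a list" where
  "word_map B R = (\<lambda>w. if \<exists>v. induces B R w v then Some (SOME v. induces B R w v) else None)"

text \<open>A right ideal homomorphism without finite generation, so that composites can be treated
  before their domains are known to be finitely generated.\<close>

definition equivariant :: "'a set \<Rightarrow> ('a list \<rightharpoonup> 'a list) \<Rightarrow> bool" where
  "equivariant B \<phi> \<longleftrightarrow> dom \<phi> \<subseteq> BA_words A B \<and> ran \<phi> \<subseteq> BA_words A B \<and>
     (\<forall>r\<in>dom \<phi>. \<forall>x\<in>lists A. \<phi> (r @ x) = Some (the (\<phi> r) @ x))"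

definition prefix_maps_on :: "'a set \<Rightarrow> ('a stream \<times> 'a stream) set set" where
  "prefix_maps_on B = {R \<in> prefix_maps A. Domain R \<subseteq> cyl A (BA_words A B) \<and>
                                       Range R \<subseteq> cyl A (BA_words A B)}"

section \<open>The action of equivariant maps on infinite words\<close>

lemma cyl_BA_words_iff: "s \<in> cyl A (BA_words A B) \<longleftrightarrow> shd s \<in> B \<and> stl s \<in> streams A"
proof
  show "s \<in> cyl A (BA_words A B) \<Longrightarrow> shd s \<in> B \<and> stl s \<in> streams A"
    by (auto simp: cyl_def BA_words_def shift_in_streams_iff)
  assume "shd s \<in> B \<and> stl s \<in> streams A"
  then show "s \<in> cyl A (BA_words A B)"
    using cylI[of "[shd s]" "BA_words A B" "stl s" A] by (simp add: BA_words_iff)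
qed

lemma shift_in_cyl_BA_words_iff:
  assumes "w \<in> BA_words A C" "z \<in> streams A"
  shows "w @- z \<in> cyl A (BA_words A B) \<longleftrightarrow> w \<in> BA_words A B"
  using assms by (cases w) (auto simp: cyl_BA_words_iff BA_words_iff shift_in_streams_iff)

lemma endsI: "\<phi> w = Some v \<Longrightarrow> z \<in> streams A \<Longrightarrow> (w @- z, v @- z) \<in> ends \<phi>"
  by (auto simp: ends_def intro: replace_prefixI)

lemma endsE:
  assumes "(x, y) \<in> ends \<phi>"
  obtains w v z where "x = w @- z" "y = v @- z" "\<phi> w = Some v" "z \<in> streams A"
  using assms by (auto simp: ends_def replace_prefix_def)

lemma Domain_ends: "Domain (ends \<phi>) = cyl A (dom \<phi>)"
proof -
  have "fst ` {(w, v). \<phi> w = Some v} = dom \<phi>" by force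
  then show ?thesis by (simp add: ends_def Domain_replace_prefix)
qed

lemma Range_ends: "Range (ends \<phi>) = cyl A (ran \<phi>)"
proof -
  have "snd ` {(w, v). \<phi> w = Some v} = ran \<phi>" by (force simp: ran_def)
  then show ?thesis by (simp add: ends_def Range_replace_prefix)
qed

lemma equivariantD:
  "equivariant B \<phi> \<Longrightarrow> \<phi> w = Some v \<Longrightarrow> set x \<subseteq> A \<Longrightarrow> \<phi> (w @ x) = Some (v @ x)"
  unfolding equivariant_def by (metis domI in_listsI option.sel subsetD)

lemma equivariant_words:
  "equivariant B \<phi> \<Longrightarrow> \<phi> w = Some v \<Longrightarrow> w \<in> BA_words A B \<and> v \<in> BA_words A B"
  by (auto simp: equivariant_def ran_def)

lemma rihom_equivariant: "rihom A B \<phi> \<Longrightarrow> equivariant B \<phi>"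
  by (auto simp: rihom_def equivariant_def fg_right_ideal_def right_ideal_def)

lemma single_valued_ends:
  assumes "equivariant B \<phi>"
  shows "single_valued (ends \<phi>)"
proof (rule single_valuedI)
  fix x y y' assume "(x, y) \<in> ends \<phi>" "(x, y') \<in> ends \<phi>"
  then obtain w v z w' v' z' where *: "x = w @- z" "y = v @- z" "\<phi> w = Some v" "z \<in> streams A"
    "w @- z = w' @- z'" "y' = v' @- z'" "\<phi> w' = Some v'" "z' \<in> streams A"
    by (metis endsE)
  from shift_eq_shiftD[OF *(5)] show "y = y'"
  proof (elim disjE exE conjE)
    fix t assume t: "w' = w @ t" "z = t @- z'"
    then have "set t \<subseteq> A" using * by (simp add: shift_in_streams_iff)
    then show ?thesis using equivariantD[OF assms *(3), of t] * t by auto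
  next
    fix t assume t: "w = w' @ t" "z' = t @- z"
    then have "set t \<subseteq> A" using * by (simp add: shift_in_streams_iff)
    then show ?thesis using equivariantD[OF assms *(7), of t] * t by auto
  qed
qed

lemma equivariant_map_comp:
  assumes "equivariant B \<phi>" "equivariant B \<psi>"
  shows "equivariant B (\<psi> \<circ>\<^sub>m \<phi>)"
  unfolding equivariant_def
proof (intro conjI ballI)
  show "dom (\<psi> \<circ>\<^sub>m \<phi>) \<subseteq> BA_words A B"
    using assms by (auto simp: map_comp_Some_iff dest: equivariant_words)
  show "ran (\<psi> \<circ>\<^sub>m \<phi>) \<subseteq> BA_words A B"
    using assms by (auto simp: map_comp_Some_iff ran_def dest: equivariant_words)
  fix r x assume r: "r \<in> dom (\<psi> \<circ>\<^sub>m \<phi>)" and x: "x \<in> lists A"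
  then obtain u v where uv: "\<phi> r = Some u" "\<psi> u = Some v" by (auto simp: map_comp_Some_iff)
  have "\<phi> (r @ x) = Some (u @ x)" "\<psi> (u @ x) = Some (v @ x)"
    using uv x assms by (auto intro!: equivariantD)
  then show "(\<psi> \<circ>\<^sub>m \<phi>) (r @ x) = Some (the ((\<psi> \<circ>\<^sub>m \<phi>) r) @ x)"
    using uv by (simp add: map_comp_def)
qed

lemma ends_map_comp:
  assumes "equivariant B \<phi>" "equivariant B \<psi>"
  shows "ends (\<psi> \<circ>\<^sub>m \<phi>) = ends \<phi> O ends \<psi>"
proof (intro equalityI subrelI)
  fix x y assume "(x, y) \<in> ends (\<psi> \<circ>\<^sub>m \<phi>)"
  then obtain w u v z where "x = w @- z" "y = v @- z" "z \<in> streams A" "\<phi> w = Some u" "\<psi> u = Some v"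
    by (auto elim!: endsE simp: map_comp_Some_iff)
  then show "(x, y) \<in> ends \<phi> O ends \<psi>" by (blast intro: endsI)
next
  fix x y assume "(x, y) \<in> ends \<phi> O ends \<psi>"
  then obtain m where m: "(x, m) \<in> ends \<phi>" "(m, y) \<in> ends \<psi>" by blast
  from m(1) obtain w v z where 1: "x = w @- z" "m = v @- z" "\<phi> w = Some v" "z \<in> streams A"
    by (rule endsE)
  from m(2) obtain w' v' z' where 2: "m = w' @- z'" "y = v' @- z'" "\<psi> w' = Some v'" "z' \<in> streams A"
    by (rule endsE)
  have *: "x = w @- z" "v @- z = w' @- z'" "\<phi> w = Some v" "z \<in> streams A"
    "y = v' @- z'" "\<psi> w' = Some v'" "z' \<in> streams A"
    using 1 2 by simp_all
  from shift_eq_shiftD[OF *(2)] show "(x, y) \<in> ends (\<psi> \<circ>\<^sub>m \<phi>)"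
  proof (elim disjE exE conjE)
    \<comment> \<open>The output \<open>v\<close> may be too short for \<open>\<psi>\<close>; the
      input is lengthened to \<open>w @ t\<close>, whose output is \<open>v @ t\<close> by
      equivariance.\<close>
    fix t assume t: "w' = v @ t" "z = t @- z'"
    then have "set t \<subseteq> A" using * by (simp add: shift_in_streams_iff)
    then have "(\<psi> \<circ>\<^sub>m \<phi>) (w @ t) = Some v'"
      using equivariantD[OF assms(1) *(3), of t] * t by simp
    then show ?thesis using endsI[of _ "w @ t" v' z'] * t by simp
  next
    fix t assume t: "v = w' @ t" "z' = t @- z"
    then have "set t \<subseteq> A" using * by (simp add: shift_in_streams_iff)
    then have "(\<psi> \<circ>\<^sub>m \<phi>) w = Some (v' @ t)"
      using equivariantD[OF assms(2) *(6), of t] * t by simp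
    then show ?thesis using endsI[of _ w "v' @ t" z] * t by simp
  qed
qed

section \<open>Recovering a map on words from its action\<close>

lemma word_map_eq_Some_iff:
  assumes "single_valued R"
  shows "word_map B R w = Some v \<longleftrightarrow> induces B R w v"
proof -
  have *: "v = v'" if "induces B R w v" "induces B R w v'" for v v'
  proof (rule shift_ext)
    show "v @- z = v' @- z" if "z \<in> streams A" for z
      using that \<open>induces B R w v\<close> \<open>induces B R w v'\<close> assms
      by (auto simp: induces_def single_valued_def)
  qed
  have "(SOME v. induces B R w v) = u" if "induces B R w u" for u
    using that * by (blast intro: some_equality)
  then show ?thesis by (auto simp: word_map_def)
qed

lemma equivariant_word_map:
  assumes "single_valued R"
  shows "equivariant B (word_map B R)"
  unfolding equivariant_def
proof (intro conjI ballI)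
  note W = word_map_eq_Some_iff[OF assms]
  show "dom (word_map B R) \<subseteq> BA_words A B" by (auto simp: W induces_def)
  show "ran (word_map B R) \<subseteq> BA_words A B" by (auto simp: W induces_def ran_def)
  fix r x assume "r \<in> dom (word_map B R)" and x: "x \<in> lists A"
  then obtain v where v: "word_map B R r = Some v" by auto
  have "induces B R (r @ x) (v @ x)"
    unfolding induces_def
  proof (intro conjI ballI)
    show "r @ x \<in> BA_words A B" "v @ x \<in> BA_words A B"
      using v x by (auto simp: W induces_def BA_words_append BA_words_iff)
    fix z assume "z \<in> streams A"
    then have "x @- z \<in> streams A" using x by (auto simp: shift_in_streams_iff)
    then show "((r @ x) @- z, (v @ x) @- z) \<in> R" using v by (simp add: W induces_def)
  qed
  then have "word_map B R (r @ x) = Some (v @ x)" by (simp add: W)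
  then show "word_map B R (r @ x) = Some (the (word_map B R r) @ x)" using v by simp
qed

text \<open>The table only promises unrestricted heads. That they lie in \<open>B\<close> follows
  from the domain and range of \<open>R\<close>, tested on a single tail.\<close>

lemma replace_prefix_induces:
  assumes "R \<in> prefix_maps_on B" "R = replace_prefix A T" "T \<subseteq> BA_words A UNIV \<times> BA_words A UNIV"
    and "(p, q) \<in> T"
  shows "induces B R p q"
proof -
  obtain z where z: "z \<in> streams A" using streams_nonempty by blast
  have *: "(p @- z, q @- z) \<in> R" if "z \<in> streams A" for z
    using assms(2,4) that by (auto intro: replace_prefixI)
  then have "p @- z \<in> cyl A (BA_words A B)" "q @- z \<in> cyl A (BA_words A B)"
    using z assms(1) by (auto simp: prefix_maps_on_def)
  moreover have "p \<in> BA_words A UNIV" "q \<in> BA_words A UNIV" using assms(3,4) by auto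
  ultimately show ?thesis
    using * z by (auto simp: induces_def shift_in_cyl_BA_words_iff)
qed

lemma ends_word_map:
  assumes "R \<in> prefix_maps_on B"
  shows "ends (word_map B R) = R"
proof -
  have "R \<in> prefix_maps A" using assms by (simp add: prefix_maps_on_def)
  then obtain T where T: "finite T" "T \<subseteq> BA_words A UNIV \<times> BA_words A UNIV" "R = replace_prefix A T"
    "single_valued R"
    by (rule prefix_mapsE)
  note W = word_map_eq_Some_iff[OF T(4)]
  show ?thesis
  proof (intro equalityI subrelI)
    fix x y assume "(x, y) \<in> ends (word_map B R)"
    then show "(x, y) \<in> R" by (auto elim!: endsE simp: W induces_def)
  next
    fix x y assume "(x, y) \<in> R"
    then obtain p q z where *: "x = p @- z" "y = q @- z" "(p, q) \<in> T" "z \<in> streams A"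
      unfolding T(3) replace_prefix_def by blast
    then have "word_map B R p = Some q"
      unfolding W using replace_prefix_induces[OF assms T(3,2)] by blast
    then show "(x, y) \<in> ends (word_map B R)" using * endsI by simp
  qed
qed

lemma map_le_word_map_ends:
  assumes "equivariant B \<phi>"
  shows "\<phi> \<subseteq>\<^sub>m word_map B (ends \<phi>)"
  unfolding map_le_def
proof
  fix w assume "w \<in> dom \<phi>"
  then obtain v where v: "\<phi> w = Some v" by auto
  then have "induces B (ends \<phi>) w v"
    using endsI equivariant_words[OF assms] by (auto simp: induces_def)
  then show "\<phi> w = word_map B (ends \<phi>) w"
    using v word_map_eq_Some_iff[OF single_valued_ends[OF assms]] by metis
qed

section \<open>Right ideals and finite generation\<close>

lemma subset_right_mult: "P \<subseteq> right_mult P A"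
proof
  fix p assume "p \<in> P"
  moreover have "p = p @ []" "[] \<in> lists A" by simp_all
  ultimately show "p \<in> right_mult P A" unfolding right_mult_def by blast
qed

lemma right_mult_idem: "right_mult (right_mult P A) A = right_mult P A"
proof
  show "right_mult (right_mult P A) A \<subseteq> right_mult P A"
    unfolding right_mult_def by (force simp: append_in_lists_conv)
  show "right_mult P A \<subseteq> right_mult (right_mult P A) A"
    by (rule subset_right_mult)
qed

lemma right_ideal_right_mult:
  assumes "P \<subseteq> BA_words A B"
  shows "right_ideal A B (right_mult P A)"
proof -
  have "right_mult P A \<subseteq> BA_words A B"
    using assms by (auto simp: right_mult_def BA_words_iff subset_iff)
  then show ?thesis by (simp add: right_ideal_def right_mult_idem)
qed

lemma cyl_right_mult: "cyl A (right_mult P A) = cyl A P"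
proof (intro equalityI subsetI)
  fix s assume "s \<in> cyl A (right_mult P A)"
  then obtain r z where "s = r @- z" "r \<in> right_mult P A" "z \<in> streams A"
    unfolding cyl_def by blast
  moreover from this obtain p x where "r = p @ x" "p \<in> P" "x \<in> lists A"
    unfolding right_mult_def by blast
  ultimately show "s \<in> cyl A P" by (auto intro!: cylI simp: shift_in_streams_iff)
next
  fix s assume "s \<in> cyl A P"
  then obtain p z where "s = p @- z" "p \<in> P" "z \<in> streams A" by (auto simp: cyl_def)
  moreover from this have "p \<in> right_mult P A" using subset_right_mult by blast
  ultimately show "s \<in> cyl A (right_mult P A)" by (auto intro: cylI)
qed

text \<open>Finite generation has to be checked for the domain only: the images of the generators
  generate the range.\<close>

lemma rihom_of_equivariant:
  assumes "equivariant B \<phi>" "finite P" "dom \<phi> = right_mult P A"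
  shows "rihom A B \<phi>"
proof -
  have P: "P \<subseteq> dom \<phi>" unfolding assms(3) by (rule subset_right_mult)
  define Q where "Q = (\<lambda>p. the (\<phi> p)) ` P"
  have sub: "P \<subseteq> BA_words A B" "Q \<subseteq> BA_words A B"
    using P equivariant_words[OF assms(1)] by (auto simp: Q_def)
  have "ran \<phi> = right_mult Q A"
  proof (intro equalityI subsetI)
    fix v assume "v \<in> ran \<phi>"
    then obtain w where w: "\<phi> w = Some v" by (auto simp: ran_def)
    then have "w \<in> right_mult P A" using assms(3) by auto
    then obtain p x where px: "w = p @ x" "p \<in> P" "x \<in> lists A" by (auto simp: right_mult_def)
    then have "\<phi> (p @ x) = Some (the (\<phi> p) @ x)" using P assms(1) by (auto simp: equivariant_def)
    then show "v \<in> right_mult Q A" using w px by (auto simp: Q_def right_mult_def)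
  next
    fix v assume "v \<in> right_mult Q A"
    then obtain p x where px: "v = the (\<phi> p) @ x" "p \<in> P" "x \<in> lists A"
      by (auto simp: right_mult_def Q_def)
    then have "\<phi> (p @ x) = Some v" using P assms(1) by (auto simp: equivariant_def)
    then show "v \<in> ran \<phi>" by (auto simp: ran_def)
  qed
  moreover have "finite Q" using assms(2) by (simp add: Q_def)
  ultimately show ?thesis
    using assms sub right_ideal_right_mult unfolding rihom_def fg_right_ideal_def equivariant_def
    by metis
qed

lemma rihom_word_map:
  assumes "R \<in> prefix_maps_on B"
  shows "rihom A B (word_map B R)"
proof -
  have "R \<in> prefix_maps A" using assms by (simp add: prefix_maps_on_def)
  then obtain T where T: "finite T" "T \<subseteq> BA_words A UNIV \<times> BA_words A UNIV" "R = replace_prefix A T"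
    "single_valued R"
    by (rule prefix_mapsE)
  note W = word_map_eq_Some_iff[OF T(4)]
  have E: "equivariant B (word_map B R)" using T(4) by (rule equivariant_word_map)
  \<comment> \<open>Every \<open>w\<close> in the domain is comparable with a left-hand word
    \<open>p\<close> of the table. Either \<open>w\<close> is a prefix of \<open>p\<close>, hence in
    \<open>P\<close>, or \<open>p\<close> itself is in \<open>P\<close> and is a prefix of
    \<open>w\<close>.\<close>
  define P where "P = {w \<in> dom (word_map B R). \<exists>p\<in>fst ` T. prefix w p}"
  have "P \<subseteq> (\<Union>p\<in>fst ` T. set (prefixes p))" by (auto simp: P_def)
  then have fin: "finite P" using T(1) finite_subset by fastforce
  have "dom (word_map B R) = right_mult P A"
  proof (intro equalityI subsetI)
    fix w assume w: "w \<in> dom (word_map B R)"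
    then obtain v where v: "induces B R w v" by (auto simp: W)
    obtain z where z: "z \<in> streams A" using streams_nonempty by blast
    then have "w @- z \<in> Domain R" using v by (auto simp: induces_def)
    then obtain p q z' where p: "(p, q) \<in> T" "w @- z = p @- z'" "z' \<in> streams A"
      unfolding T(3) replace_prefix_def by blast
    from shift_eq_shiftD[OF p(2)] show "w \<in> right_mult P A"
    proof (elim disjE exE conjE)
      fix t assume "p = w @ t"
      then have "prefix w p" by simp
      then have "w \<in> P" using w p(1) by (force simp: P_def)
      then show ?thesis using subset_right_mult by blast
    next
      fix t assume t: "w = p @ t" "z' = t @- z"
      have "word_map B R p = Some q"
        unfolding W using replace_prefix_induces[OF assms T(3,2) p(1)] .
      then have "p \<in> P" using p(1) by (force simp: P_def)
      moreover have "t \<in> lists A" using t p(3) by (auto simp: shift_in_streams_iff)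
      ultimately show ?thesis using t by (auto simp: right_mult_def)
    qed
  next
    fix w assume "w \<in> right_mult P A"
    then obtain p v x where "w = p @ x" "word_map B R p = Some v" "set x \<subseteq> A"
      by (auto simp: right_mult_def P_def)
    then show "w \<in> dom (word_map B R)" using equivariantD[OF E] by blast
  qed
  then show ?thesis using E fin by (rule rihom_of_equivariant[rotated 2])
qed

text \<open>Finitely many generators of the domain form a table for the whole action: their entries
  cover the domain of \<open>ends \<phi>\<close>, which is single-valued.\<close>

lemma ends_rihom:
  assumes "rihom A B \<phi>"
  shows "ends \<phi> \<in> prefix_maps_on B"
proof -
  have E: "equivariant B \<phi>" using assms by (rule rihom_equivariant)
  obtain P where P: "finite P" "P \<subseteq> BA_words A B" "dom \<phi> = right_mult P A"
    using assms by (auto simp: rihom_def fg_right_ideal_def)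
  have Pd: "P \<subseteq> dom \<phi>" unfolding P(3) by (rule subset_right_mult)
  define T where "T = (\<lambda>p. (p, the (\<phi> p))) ` P"
  have T: "T \<subseteq> {(w, v). \<phi> w = Some v}" using Pd by (auto simp: T_def)
  have sub: "replace_prefix A T \<subseteq> ends \<phi>" using T by (auto simp: ends_def replace_prefix_def)
  have "fst ` T = P" by (force simp: T_def)
  then have "Domain (replace_prefix A T) = Domain (ends \<phi>)"
    by (simp add: Domain_replace_prefix Domain_ends P(3) cyl_right_mult)
  with sub single_valued_ends[OF E] have eq: "ends \<phi> = replace_prefix A T"
    unfolding single_valued_def by fast
  have "T \<subseteq> BA_words A B \<times> BA_words A B" using T equivariant_words[OF E] by auto
  then have "T \<subseteq> BA_words A UNIV \<times> BA_words A UNIV" using BA_words_mono[of B UNIV A] by blast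
  then have "ends \<phi> \<in> prefix_maps A"
    using eq single_valued_ends[OF E] P(1) by (auto simp: prefix_maps_def T_def)
  moreover have "Domain (ends \<phi>) \<subseteq> cyl A (BA_words A B)" "Range (ends \<phi>) \<subseteq> cyl A (BA_words A B)"
    unfolding Domain_ends Range_ends using E by (auto simp: equivariant_def intro!: cyl_mono)
  ultimately show ?thesis by (simp add: prefix_maps_on_def)
qed

section \<open>Essential equality and the maximal extension\<close>

lemma right_ideal_append:
  assumes "right_ideal A B R" "r \<in> R" "set x \<subseteq> A"
  shows "r @ x \<in> R"
proof -
  have "r @ x \<in> right_mult R A" using assms(2,3) unfolding right_mult_def by blast
  then show ?thesis using assms(1) by (simp add: right_ideal_def)
qed

text \<open>Whether right ideals meet depends only on their cylinders: a common word
  \<open>r\<close> continues to an infinite word that also has a prefix \<open>r'\<close> in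
  \<open>S'\<close>, and the longer of \<open>r\<close> and \<open>r'\<close> lies in
  \<open>R \<inter> S'\<close>.\<close>

lemma inter_right_ideal_of_cyl_subset:
  assumes "right_ideal A B R" "right_ideal A B S" "right_ideal A B S'"
    and "cyl A S \<subseteq> cyl A S'" "R \<inter> S \<noteq> {}"
  shows "R \<inter> S' \<noteq> {}"
proof -
  obtain r where r: "r \<in> R" "r \<in> S" using assms(5) by blast
  obtain z where z: "z \<in> streams A" using streams_nonempty by blast
  then have "r @- z \<in> cyl A S'" using r assms(4) cylI by blast
  then obtain r' z' where r': "r @- z = r' @- z'" "r' \<in> S'" "z' \<in> streams A" by (auto simp: cyl_def)
  from shift_eq_shiftD[OF r'(1)] show ?thesis
  proof (elim disjE exE conjE)
    fix t assume t: "r' = r @ t" "z = t @- z'"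
    then have "set t \<subseteq> A" using z by (simp add: shift_in_streams_iff)
    then have "r' \<in> R" using r(1) t(1) right_ideal_append[OF assms(1)] by blast
    then show ?thesis using r'(2) by blast
  next
    fix t assume t: "r = r' @ t" "z' = t @- z"
    then have "set t \<subseteq> A" using r'(3) by (simp add: shift_in_streams_iff)
    then have "r \<in> S'" using r'(2) t(1) right_ideal_append[OF assms(3)] by blast
    then show ?thesis using r(1) by blast
  qed
qed

text \<open>Cut the infinite word at a \<open>w\<close> in \<open>R\<close> at least as long as all
  words of the finite set \<open>Q\<close>. The ideal generated by \<open>w\<close> meets
  \<open>R\<close>, hence \<open>S\<close>, so some continuation of \<open>w\<close> has a prefix in
  \<open>Q\<close>, which is already a prefix of \<open>w\<close>.\<close>

lemma cyl_subset_of_ess_eq_ideal: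
  assumes "ess_eq_ideal A B R S" "right_ideal A B R" "cyl A S = cyl A Q" "finite Q"
  shows "cyl A R \<subseteq> cyl A S"
proof
  fix s assume "s \<in> cyl A R"
  then obtain r z where r: "s = r @- z" "r \<in> R" "z \<in> streams A" by (auto simp: cyl_def)
  define N where "N = Max (insert 0 (length ` Q))"
  have N: "\<And>p. p \<in> Q \<Longrightarrow> length p \<le> N" unfolding N_def using assms(4) by (intro Max_ge) auto
  define w where "w = r @ stake N z"
  have s: "s = w @- sdrop N z" by (simp add: w_def r stake_sdrop)
  have z': "set (stake N z) \<subseteq> A" "sdrop N z \<in> streams A"
    using r(3) stake_sdrop[of N z] shift_in_streams_iff[of "stake N z" "sdrop N z" A] by auto
  have w: "w \<in> R" unfolding w_def using assms(2) r(2) z'(1) by (rule right_ideal_append)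
  then have "right_ideal A B (right_mult {w} A)"
    using assms(2) by (intro right_ideal_right_mult) (auto simp: right_ideal_def)
  moreover have "w \<in> right_mult {w} A" using subset_right_mult by blast
  ultimately have "right_mult {w} A \<inter> S \<noteq> {}"
    using w assms(1) by (auto simp: ess_eq_ideal_def)
  then obtain x where x: "x \<in> lists A" "w @ x \<in> S" by (auto simp: right_mult_def)
  obtain y where y: "y \<in> streams A" using streams_nonempty by blast
  have "(w @ x) @- y \<in> cyl A Q" using x y cylI assms(3) by blast
  then obtain q y' where q: "w @- (x @- y) = q @- y'" "q \<in> Q" "y' \<in> streams A" by (auto simp: cyl_def)
  have "length q \<le> length w" using N[OF q(2)] by (simp add: w_def)
  then obtain t where t: "w = q @ t" "y' = t @- (x @- y)"
    using shift_eq_shiftD[OF q(1)] by auto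
  then have "set t \<subseteq> A" using q(3) by (simp add: shift_in_streams_iff)
  then have "t @- sdrop N z \<in> streams A" using z' by (simp add: shift_in_streams_iff)
  then have "s \<in> cyl A Q" using cylI[OF q(2)] s t by simp
  then show "s \<in> cyl A S" using assms(3) by simp
qed

lemma prefix_maps_Domain: "R \<in> prefix_maps A \<Longrightarrow> \<exists>P. finite P \<and> P \<subseteq> BA_words A UNIV \<and> Domain R = cyl A P"
  by (elim prefix_mapsE) (auto simp: Domain_replace_prefix intro!: exI[of _ "fst ` _"])

lemma right_ideal_dom:
  assumes "equivariant B \<phi>"
  shows "right_ideal A B (dom \<phi>)"
proof -
  have "right_mult (dom \<phi>) A \<subseteq> dom \<phi>"
    using equivariantD[OF assms] by (fastforce simp: right_mult_def)
  then show ?thesis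
    using assms subset_right_mult[of "dom \<phi>"] by (auto simp: right_ideal_def equivariant_def)
qed

text \<open>Every essentially equal extension has the same action as \<open>\<phi>\<close>, so
  \<open>word_map\<close> yields the greatest one and not just a maximal one. The hypothesis
  concerns the action, so that a composite of homomorphisms qualifies directly.\<close>

lemma max_ext_eq:
  assumes E: "equivariant B \<phi>" and pm: "ends \<phi> \<in> prefix_maps A"
  shows "max_ext A B \<phi> = word_map B (ends \<phi>)"
proof -
  define \<mu> where "\<mu> = word_map B (ends \<phi>)"
  have "Domain (ends \<phi>) \<subseteq> cyl A (BA_words A B)" "Range (ends \<phi>) \<subseteq> cyl A (BA_words A B)"
    unfolding Domain_ends Range_ends using E by (auto simp: equivariant_def intro!: cyl_mono)
  then have on: "ends \<phi> \<in> prefix_maps_on B" using pm by (simp add: prefix_maps_on_def)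
  have hom: "rihom A B \<mu>" unfolding \<mu>_def using on by (rule rihom_word_map)
  have le: "\<phi> \<subseteq>\<^sub>m \<mu>" unfolding \<mu>_def using E by (rule map_le_word_map_ends)
  have "cyl A (dom \<phi>) = cyl A (dom \<mu>)"
    using ends_word_map[OF on] unfolding \<mu>_def by (metis Domain_ends)
  then have "ess_eq_ideal A B (dom \<phi>) (dom \<mu>)"
    unfolding ess_eq_ideal_def
    using inter_right_ideal_of_cyl_subset right_ideal_dom[OF E]
      right_ideal_dom[OF rihom_equivariant[OF hom]] by (metis order_refl)
  with hom le have \<mu>: "\<mu> \<in> ess_eq_extensions A B \<phi>"
    by (auto simp: ess_eq_extensions_def ess_eq_def map_le_def)
  have max: "\<chi> \<subseteq>\<^sub>m \<mu>" if "\<chi> \<in> ess_eq_extensions A B \<phi>" for \<chi>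
  proof -
    have \<chi>: "rihom A B \<chi>" "ess_eq_ideal A B (dom \<phi>) (dom \<chi>)" "\<phi> \<subseteq>\<^sub>m \<chi>"
      using that by (auto simp: ess_eq_extensions_def ess_eq_def)
    have E': "equivariant B \<chi>" using \<chi>(1) by (rule rihom_equivariant)
    obtain Q where Q: "finite Q" "cyl A (dom \<phi>) = cyl A Q"
      using prefix_maps_Domain[OF pm] by (auto simp: Domain_ends)
    have "ess_eq_ideal A B (dom \<chi>) (dom \<phi>)" using \<chi>(2) by (auto simp: ess_eq_ideal_def)
    then have "Domain (ends \<chi>) \<subseteq> Domain (ends \<phi>)"
      unfolding Domain_ends using right_ideal_dom[OF E'] Q(2,1) by (rule cyl_subset_of_ess_eq_ideal)
    moreover have "ends \<phi> \<subseteq> ends \<chi>"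
      using \<chi>(3) by (auto elim!: endsE intro!: endsI simp: map_le_def dom_def)
    ultimately have "ends \<chi> = ends \<phi>"
      using single_valued_ends[OF E'] unfolding single_valued_def by fast
    then show ?thesis using map_le_word_map_ends[OF E'] by (simp add: \<mu>_def)
  qed
  show ?thesis
    unfolding max_ext_def \<mu>_def[symmetric]
  proof (rule the_equality)
    show "\<mu> \<in> ess_eq_extensions A B \<phi> \<and> (\<forall>\<chi>\<in>ess_eq_extensions A B \<phi>. \<mu> \<subseteq>\<^sub>m \<chi> \<longrightarrow> \<chi> = \<mu>)"
      using \<mu> max map_le_antisym by blast
    show "\<psi> = \<mu>" if "\<psi> \<in> ess_eq_extensions A B \<phi> \<and>
        (\<forall>\<chi>\<in>ess_eq_extensions A B \<phi>. \<psi> \<subseteq>\<^sub>m \<chi> \<longrightarrow> \<chi> = \<psi>)" for \<psi>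
      using that \<mu> max by blast
  qed
qed

end

section \<open>The monoids as semigroups of relations\<close>

text \<open>
  The product \<open>\<psi>\<phi>\<close> applies \<open>\<phi>\<close> first, so it corresponds to \<^term>\<open>R O S\<close> with \<open>R\<close> coming from \<open>\<phi>\<close>.
\<close>
locale ends_semigroup = alphabet A for A :: "'a set" +
  fixes B :: "'a set" and M :: "('a list \<rightharpoonup> 'a list) monoid" and K :: "('a stream \<times> 'a stream) set set"
  assumes K_subset: "K \<subseteq> prefix_maps_on B"
    and K_relcomp: "\<And>R S. R \<in> K \<Longrightarrow> S \<in> K \<Longrightarrow> R O S \<in> K"
    and carrier_M: "carrier M = word_map B ` K"
    and mult_M: "\<And>\<phi> \<psi>. \<phi> \<in> carrier M \<Longrightarrow> \<psi> \<in> carrier M \<Longrightarrow> \<psi> \<otimes>\<^bsub>M\<^esub> \<phi> = word_map B (ends \<phi> O ends \<psi>)"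
begin

lemma ends_word_map_K: "R \<in> K \<Longrightarrow> ends (word_map B R) = R"
  using K_subset ends_word_map by blast

lemma ends_in_K: "\<phi> \<in> carrier M \<Longrightarrow> ends \<phi> \<in> K"
  by (auto simp: carrier_M ends_word_map_K)

lemma word_map_in_carrier: "R \<in> K \<Longrightarrow> word_map B R \<in> carrier M"
  by (simp add: carrier_M)

lemma word_map_ends: "\<phi> \<in> carrier M \<Longrightarrow> word_map B (ends \<phi>) = \<phi>"
  by (auto simp: carrier_M ends_word_map_K)

lemma ends_eq_iff: "\<phi> \<in> carrier M \<Longrightarrow> \<psi> \<in> carrier M \<Longrightarrow> ends \<phi> = ends \<psi> \<longleftrightarrow> \<phi> = \<psi>"
  by (metis word_map_ends)

lemma mult_closed: "\<phi> \<in> carrier M \<Longrightarrow> \<psi> \<in> carrier M \<Longrightarrow> \<psi> \<otimes>\<^bsub>M\<^esub> \<phi> \<in> carrier M"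
  by (simp add: mult_M word_map_in_carrier K_relcomp ends_in_K)

lemma ends_mult: "\<phi> \<in> carrier M \<Longrightarrow> \<psi> \<in> carrier M \<Longrightarrow> ends (\<psi> \<otimes>\<^bsub>M\<^esub> \<phi>) = ends \<phi> O ends \<psi>"
  by (simp add: mult_M ends_word_map_K K_relcomp ends_in_K)

lemma mult_assoc:
  assumes "\<phi> \<in> carrier M" "\<psi> \<in> carrier M" "\<chi> \<in> carrier M"
  shows "(\<phi> \<otimes>\<^bsub>M\<^esub> \<psi>) \<otimes>\<^bsub>M\<^esub> \<chi> = \<phi> \<otimes>\<^bsub>M\<^esub> (\<psi> \<otimes>\<^bsub>M\<^esub> \<chi>)"
  by (subst ends_eq_iff[symmetric]) (simp_all add: assms mult_closed ends_mult O_assoc)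

lemma K_single_valued: "R \<in> K \<Longrightarrow> single_valued R"
  using K_subset by (auto simp: prefix_maps_on_def intro: prefix_maps_single_valued)

lemma K_prefix_maps: "R \<in> K \<Longrightarrow> R \<in> prefix_maps A"
  using K_subset by (auto simp: prefix_maps_on_def)

lemma ends_eq_empty_iff: "\<phi> \<in> carrier M \<Longrightarrow> ends \<phi> = {} \<longleftrightarrow> \<phi> = Map.empty"
proof
  assume "ends \<phi> = {}"
  moreover obtain z where "z \<in> streams A" using streams_nonempty by blast
  ultimately have "\<phi> w = None" for w
    using endsI[of \<phi> w _ z] by (cases "\<phi> w") auto
  then show "\<phi> = Map.empty" by blast
qed (auto elim: endsE)

end

context alphabet
begin

section \<open>\<open>M_monoid\<close> and \<open>Inv_monoid\<close> as semigroups of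
  relations\<close>

lemma prefix_maps_on_relcomp:
  assumes "R \<in> prefix_maps_on B" "S \<in> prefix_maps_on B"
  shows "R O S \<in> prefix_maps_on B"
proof -
  have "Domain (R O S) \<subseteq> Domain R" "Range (R O S) \<subseteq> Range S" by blast+
  then show ?thesis using assms prefix_maps_relcomp unfolding prefix_maps_on_def by blast
qed

lemma max_ext_rihom: "rihom A B \<phi> \<Longrightarrow> max_ext A B \<phi> = word_map B (ends \<phi>)"
  using max_ext_eq rihom_equivariant ends_rihom by (auto simp: prefix_maps_on_def)

lemma M_monoid_carrier: "carrier (M_monoid A B) = word_map B ` prefix_maps_on B"
proof (intro equalityI subsetI)
  fix \<phi> assume "\<phi> \<in> carrier (M_monoid A B)"
  then have "rihom A B \<phi>" "word_map B (ends \<phi>) = \<phi>" by (auto simp: M_monoid_def max_ext_rihom)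
  then show "\<phi> \<in> word_map B ` prefix_maps_on B" using ends_rihom by (metis imageI)
next
  fix \<phi> assume "\<phi> \<in> word_map B ` prefix_maps_on B"
  then obtain R where "R \<in> prefix_maps_on B" "\<phi> = word_map B R" by blast
  then show "\<phi> \<in> carrier (M_monoid A B)"
    by (auto simp: M_monoid_def rihom_word_map max_ext_rihom ends_word_map)
qed

lemma M_monoid_mult:
  assumes "\<phi> \<in> carrier (M_monoid A B)" "\<psi> \<in> carrier (M_monoid A B)"
  shows "\<psi> \<otimes>\<^bsub>M_monoid A B\<^esub> \<phi> = word_map B (ends \<phi> O ends \<psi>)"
proof -
  have hom: "rihom A B \<phi>" "rihom A B \<psi>" using assms by (auto simp: M_monoid_def)
  have E: "ends (\<psi> \<circ>\<^sub>m \<phi>) = ends \<phi> O ends \<psi>"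
    using hom by (intro ends_map_comp[where B = B] rihom_equivariant)
  have "ends \<phi> O ends \<psi> \<in> prefix_maps A"
    using hom by (intro prefix_maps_relcomp) (auto dest: ends_rihom simp: prefix_maps_on_def)
  then have "max_ext A B (\<psi> \<circ>\<^sub>m \<phi>) = word_map B (ends \<phi> O ends \<psi>)"
    using hom E by (metis max_ext_eq equivariant_map_comp rihom_equivariant)
  then show ?thesis by (simp add: M_monoid_def)
qed

sublocale M: ends_semigroup A B "M_monoid A B" "prefix_maps_on B" for B
  by unfold_locales (auto simp: M_monoid_carrier prefix_maps_on_relcomp intro: M_monoid_mult[unfolded M_monoid_carrier])

lemma inj_on_iff_ends:
  assumes "equivariant B \<phi>"
  shows "inj_on \<phi> (dom \<phi>) \<longleftrightarrow> single_valued ((ends \<phi>)\<inverse>)"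
proof
  assume inj: "inj_on \<phi> (dom \<phi>)"
  \<comment> \<open>The two output words are comparable, and \<open>v @ t\<close> stands for the
    longer one; both cases below are instances.\<close>
  have wlog: "w @- z = w' @- t @- z" if "\<phi> w = Some (v @ t)" "\<phi> w' = Some v" "set t \<subseteq> A"
    for w w' v t z
  proof -
    have "\<phi> (w' @ t) = Some (v @ t)" using assms that(2,3) by (rule equivariantD)
    then have "w = w' @ t" using inj that(1) by (metis domI inj_onD)
    then show ?thesis by simp
  qed
  show "single_valued ((ends \<phi>)\<inverse>)"
  proof (rule single_valuedI)
    fix y x x' assume "(y, x) \<in> (ends \<phi>)\<inverse>" "(y, x') \<in> (ends \<phi>)\<inverse>"
    then have x: "(x, y) \<in> ends \<phi>" and x': "(x', y) \<in> ends \<phi>" by auto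
    from x obtain w v z where 1: "x = w @- z" "y = v @- z" "\<phi> w = Some v" "z \<in> streams A"
      by (rule endsE)
    from x' obtain w' v' z' where 2: "x' = w' @- z'" "y = v' @- z'" "\<phi> w' = Some v'" "z' \<in> streams A"
      by (rule endsE)
    have "v @- z = v' @- z'" using 1 2 by simp
    then show "x = x'"
    proof (elim disjE exE conjE shift_eq_shiftD[elim_format])
      fix t assume "v' = v @ t" "z = t @- z'"
      moreover from this have "set t \<subseteq> A" using 1 by (simp add: shift_in_streams_iff)
      ultimately show ?thesis using wlog[of w' v t w z'] 1 2 by auto
    next
      fix t assume "v = v' @ t" "z' = t @- z"
      moreover from this have "set t \<subseteq> A" using 2 by (simp add: shift_in_streams_iff)
      ultimately show ?thesis using wlog[of w v' t w' z] 1 2 by auto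
    qed
  qed
next
  assume sv: "single_valued ((ends \<phi>)\<inverse>)"
  show "inj_on \<phi> (dom \<phi>)"
  proof (rule inj_onI)
    fix w w' assume "w \<in> dom \<phi>" "w' \<in> dom \<phi>" "\<phi> w = \<phi> w'"
    then obtain v where "\<phi> w = Some v" "\<phi> w' = Some v" by auto
    then have "w @- z = w' @- z" if "z \<in> streams A" for z
      using sv that endsI unfolding single_valued_def by blast
    then show "w = w'" by (rule shift_ext)
  qed
qed

lemma relcomp_inj:
  "single_valued (R\<inverse>) \<Longrightarrow> single_valued (S\<inverse>) \<Longrightarrow> single_valued ((R O S)\<inverse>)"
  by (simp add: converse_relcomp single_valued_relcomp)

sublocale Inv: ends_semigroup A B "Inv_monoid A B" "{R \<in> prefix_maps_on B. single_valued (R\<inverse>)}" for B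
proof unfold_locales
  show C: "carrier (Inv_monoid A B) = word_map B ` {R \<in> prefix_maps_on B. single_valued (R\<inverse>)}"
  proof -
    have "inj_on (word_map B R) (dom (word_map B R)) \<longleftrightarrow> single_valued (R\<inverse>)"
      if "R \<in> prefix_maps_on B" for R
      using inj_on_iff_ends[OF rihom_equivariant[OF rihom_word_map[OF that]]] ends_word_map[OF that]
      by simp
    then show ?thesis by (auto simp: Inv_monoid_def M_monoid_carrier)
  qed
  show "\<psi> \<otimes>\<^bsub>Inv_monoid A B\<^esub> \<phi> = word_map B (ends \<phi> O ends \<psi>)"
    if "\<phi> \<in> carrier (Inv_monoid A B)" "\<psi> \<in> carrier (Inv_monoid A B)" for \<phi> \<psi>
    using that M_monoid_mult[of \<phi> B \<psi>] by (simp add: Inv_monoid_def)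
qed (auto intro: relcomp_inj prefix_maps_on_relcomp)

text \<open>Essential means essentially equal to \<open>BA_words A B\<close>, and essential equality
  amounts to equality of cylinders by the two comparison lemmas.\<close>

lemma essential_iff:
  assumes "right_ideal A B R" "finite P" "cyl A R = cyl A P" "finite B"
  shows "essential A B R \<longleftrightarrow> cyl A R = cyl A (BA_words A B)"
proof -
  have BA: "right_ideal A B (BA_words A B)"
    unfolding right_ideal_def using subset_right_mult[of "BA_words A B"]
    by (auto simp: right_mult_def BA_words_def)
  have "right_mult ((\<lambda>b. [b]) ` B) A = {[b] @ x | b x. b \<in> B \<and> x \<in> lists A}"
    unfolding right_mult_def by blast
  then have "right_mult ((\<lambda>b. [b]) ` B) A = BA_words A B" by (simp add: BA_words_def)
  then have cBA: "cyl A (BA_words A B) = cyl A ((\<lambda>b. [b]) ` B)" by (metis cyl_right_mult)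
  have sub: "R \<subseteq> BA_words A B" using assms(1) by (simp add: right_ideal_def)
  have "S \<inter> BA_words A B = S" if "right_ideal A B S" for S
    using that by (auto simp: right_ideal_def)
  then have "essential A B R \<longleftrightarrow> ess_eq_ideal A B (BA_words A B) R"
    using sub assms(1) unfolding essential_def ess_eq_ideal_def by (simp add: Int_commute) blast
  also have "\<dots> \<longleftrightarrow> cyl A R = cyl A (BA_words A B)"
  proof
    assume "ess_eq_ideal A B (BA_words A B) R"
    then have "cyl A (BA_words A B) \<subseteq> cyl A R"
      using BA assms(3,2) by (rule cyl_subset_of_ess_eq_ideal)
    then show "cyl A R = cyl A (BA_words A B)" using cyl_mono[OF sub] by blast
  next
    assume "cyl A R = cyl A (BA_words A B)"
    then show "ess_eq_ideal A B (BA_words A B) R"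
      unfolding ess_eq_ideal_def
      using inter_right_ideal_of_cyl_subset BA assms(1) by (metis order_refl)
  qed
  finally show ?thesis .
qed

section \<open>The group of full bijections\<close>

lemma prefix_maps_Range:
  "R \<in> prefix_maps A \<Longrightarrow> \<exists>P. finite P \<and> P \<subseteq> BA_words A UNIV \<and> Range R = cyl A P"
  by (elim prefix_mapsE) (auto simp: Range_replace_prefix intro!: exI[of _ "snd ` _"])

text \<open>The actions of the elements of \<open>G_group A B\<close>.\<close>

definition full_bijections :: "'a set \<Rightarrow> ('a stream \<times> 'a stream) set set" where
  "full_bijections B = {R \<in> prefix_maps_on B. single_valued (R\<inverse>) \<and>
     Domain R = cyl A (BA_words A B) \<and> Range R = cyl A (BA_words A B)}"

lemma riiso_iff:
  assumes "finite B" "rihom A B \<phi>"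
  shows "riiso A B \<phi> \<longleftrightarrow> ends \<phi> \<in> full_bijections B"
proof -
  have R: "ends \<phi> \<in> prefix_maps_on B" using assms(2) by (rule ends_rihom)
  then have pm: "ends \<phi> \<in> prefix_maps A" by (simp add: prefix_maps_on_def)
  have "right_ideal A B (dom \<phi>)" "right_ideal A B (ran \<phi>)"
    using assms(2) by (auto simp: rihom_def fg_right_ideal_def)
  then have "essential A B (dom \<phi>) \<longleftrightarrow> Domain (ends \<phi>) = cyl A (BA_words A B)"
    "essential A B (ran \<phi>) \<longleftrightarrow> Range (ends \<phi>) = cyl A (BA_words A B)"
    using essential_iff assms(1) prefix_maps_Domain[OF pm] prefix_maps_Range[OF pm]
    unfolding Domain_ends Range_ends by metis+
  then show ?thesis
    using R assms(2) inj_on_iff_ends[OF rihom_equivariant[OF assms(2)]]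
    by (auto simp: riiso_def full_bijections_def)
qed

lemma ends_semigroup_G_group:
  assumes "finite B"
  shows "ends_semigroup A B (G_group A B) (full_bijections B)"
proof unfold_locales
  show "full_bijections B \<subseteq> prefix_maps_on B" by (auto simp: full_bijections_def)
  show "R O S \<in> full_bijections B" if "R \<in> full_bijections B" "S \<in> full_bijections B" for R S
  proof -
    have "Domain (R O S) = Domain R" "Range (R O S) = Range S"
      using that unfolding full_bijections_def by blast+
    then show ?thesis
      using that relcomp_inj[of R S] prefix_maps_on_relcomp[of R B S]
      unfolding full_bijections_def mem_Collect_eq by metis
  qed
  show "carrier (G_group A B) = word_map B ` full_bijections B"
    using riiso_iff[OF assms] rihom_word_map ends_word_map
    by (auto simp: G_group_def M_monoid_carrier full_bijections_def)
  show "\<psi> \<otimes>\<^bsub>G_group A B\<^esub> \<phi> = word_map B (ends \<phi> O ends \<psi>)"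
    if "\<phi> \<in> carrier (G_group A B)" "\<psi> \<in> carrier (G_group A B)" for \<phi> \<psi>
    using that M_monoid_mult[of \<phi> B \<psi>] by (simp add: G_group_def)
qed

section \<open>The image code\<close>

lemma right_mult_prefix_code_inj:
  assumes "prefix_code A B P" "prefix_code A C Q" "right_mult P A = right_mult Q A"
  shows "P = Q"
proof -
  have "P \<subseteq> Q" if P: "prefix_code A B P" and eq: "right_mult P A = right_mult Q A" for P Q B
  proof
    fix p assume p: "p \<in> P"
    then have "p \<in> right_mult Q A" using subset_right_mult eq by blast
    then obtain q x where q: "p = q @ x" "q \<in> Q" by (auto simp: right_mult_def)
    then have "q \<in> right_mult P A" using subset_right_mult eq by blast
    then obtain r y where r: "q = r @ y" "r \<in> P" by (auto simp: right_mult_def)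
    \<comment> \<open>\<open>p\<close> begins with \<open>q\<close>, which begins with
      \<open>r\<close>; both \<open>p\<close> and \<open>r\<close> are in \<open>P\<close>, so all
      three coincide.\<close>
    have "y @ x = []" using prefix_codeD[OF P r(2), of "y @ x"] p q r by simp
    then show "p \<in> Q" using q by simp
  qed
  then show ?thesis using assms by (metis subset_antisym)
qed

lemma right_mult_mono: "P \<subseteq> Q \<Longrightarrow> right_mult P A \<subseteq> right_mult Q A"
  by (auto simp: right_mult_def)

text \<open>The minimal words of any finite generating set of the range form the code, and
  uniqueness lets \<open>THE\<close> denote it.\<close>

lemma imC_rihom:
  assumes "rihom A B \<phi>"
  shows "finite (imC A B \<phi>)" "prefix_code A B (imC A B \<phi>)" "cyl A (imC A B \<phi>) = Range (ends \<phi>)"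
proof -
  obtain P where P: "finite P" "P \<subseteq> BA_words A B" "ran \<phi> = right_mult P A"
    using assms by (auto simp: rihom_def fg_right_ideal_def)
  define Q where "Q = min_words P"
  have code: "finite Q" "prefix_code A B Q"
    using P(1) prefix_code_min_words[OF P(2)] finite_subset[OF min_words_subset] by (auto simp: Q_def)
  have "right_mult Q A = right_mult P A"
  proof
    show "right_mult Q A \<subseteq> right_mult P A"
      unfolding Q_def using min_words_subset by (rule right_mult_mono)
    have "P \<subseteq> right_mult Q A"
    proof
      fix p assume p: "p \<in> P"
      then obtain q t where q: "q \<in> Q" "p = q @ t"
        using min_words_prefix[OF p] by (auto simp: Q_def prefix_def)
      have "q @ t \<in> BA_words A B" "q \<in> BA_words A B" using p q P(2) min_words_subset by (auto simp: Q_def)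
      then have "set t \<subseteq> A" using BA_words_append by blast
      then show "p \<in> right_mult Q A" using q by (auto simp: right_mult_def)
    qed
    then have "right_mult P A \<subseteq> right_mult (right_mult Q A) A" by (rule right_mult_mono)
    then show "right_mult P A \<subseteq> right_mult Q A" by (simp only: right_mult_idem)
  qed
  then have "ran \<phi> = right_mult Q A" using P(3) by simp
  then have "imC A B \<phi> = Q"
    unfolding imC_def
    by (intro the_equality) (use code right_mult_prefix_code_inj[of B _ B Q] in metis)+
  then show "finite (imC A B \<phi>)" "prefix_code A B (imC A B \<phi>)" "cyl A (imC A B \<phi>) = Range (ends \<phi>)"
    using code \<open>ran \<phi> = right_mult Q A\<close> by (simp_all add: Range_ends cyl_right_mult)
qed

end

section \<open>Maximal subgroups\<close>

text \<open>For an idempotent \<open>e\<close> this is the group of units of \<open>eMe\<close>,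
  which is the Green H-class of \<open>e\<close>.\<close>

definition unit_group :: "('m, 'r) monoid_scheme \<Rightarrow> 'm \<Rightarrow> 'm set" where
  "unit_group M e = {f \<in> carrier M. e \<otimes>\<^bsub>M\<^esub> f = f \<and> f \<otimes>\<^bsub>M\<^esub> e = f \<and>
     (\<exists>g\<in>carrier M. e \<otimes>\<^bsub>M\<^esub> g = g \<and> g \<otimes>\<^bsub>M\<^esub> e = g \<and>
                  f \<otimes>\<^bsub>M\<^esub> g = e \<and> g \<otimes>\<^bsub>M\<^esub> f = e)}"

context ends_semigroup
begin

lemma semigroup_subgroup_unit_group:
  assumes e: "e \<in> carrier M" "e \<otimes>\<^bsub>M\<^esub> e = e"
  shows "semigroup_subgroup M (unit_group M e)" "e \<in> unit_group M e"
proof -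
  show e': "e \<in> unit_group M e" using e by (auto simp: unit_group_def)
  have "group (M\<lparr>carrier := unit_group M e, one := e\<rparr>)"
  proof (rule groupI, simp_all)
    show "e \<in> unit_group M e" by fact
    show "x \<otimes>\<^bsub>M\<^esub> y \<in> unit_group M e" if x: "x \<in> unit_group M e" and y: "y \<in> unit_group M e" for x y
    proof -
      obtain x' where x': "x' \<in> carrier M" "e \<otimes>\<^bsub>M\<^esub> x' = x'" "x' \<otimes>\<^bsub>M\<^esub> e = x'" "x \<otimes>\<^bsub>M\<^esub> x' = e" "x' \<otimes>\<^bsub>M\<^esub> x = e"
        using x by (auto simp: unit_group_def)
      obtain y' where y': "y' \<in> carrier M" "e \<otimes>\<^bsub>M\<^esub> y' = y'" "y' \<otimes>\<^bsub>M\<^esub> e = y'" "y \<otimes>\<^bsub>M\<^esub> y' = e" "y' \<otimes>\<^bsub>M\<^esub> y = e"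
        using y by (auto simp: unit_group_def)
      have xy: "x \<in> carrier M" "e \<otimes>\<^bsub>M\<^esub> x = x" "x \<otimes>\<^bsub>M\<^esub> e = x" "y \<in> carrier M" "e \<otimes>\<^bsub>M\<^esub> y = y" "y \<otimes>\<^bsub>M\<^esub> e = y"
        using x y by (auto simp: unit_group_def)
      have "e \<otimes>\<^bsub>M\<^esub> (x \<otimes>\<^bsub>M\<^esub> y) = x \<otimes>\<^bsub>M\<^esub> y"
        using xy e mult_assoc[of e x y] by simp
      moreover have "(x \<otimes>\<^bsub>M\<^esub> y) \<otimes>\<^bsub>M\<^esub> e = x \<otimes>\<^bsub>M\<^esub> y"
        using xy e mult_assoc[of x y e] by simp
      moreover have "e \<otimes>\<^bsub>M\<^esub> (y' \<otimes>\<^bsub>M\<^esub> x') = y' \<otimes>\<^bsub>M\<^esub> x'"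
        using x' y' e mult_assoc[of e y' x'] by simp
      moreover have "(y' \<otimes>\<^bsub>M\<^esub> x') \<otimes>\<^bsub>M\<^esub> e = y' \<otimes>\<^bsub>M\<^esub> x'"
        using x' y' e mult_assoc[of y' x' e] by simp
      moreover have "(x \<otimes>\<^bsub>M\<^esub> y) \<otimes>\<^bsub>M\<^esub> (y' \<otimes>\<^bsub>M\<^esub> x') = e"
      proof -
        have "(x \<otimes>\<^bsub>M\<^esub> y) \<otimes>\<^bsub>M\<^esub> (y' \<otimes>\<^bsub>M\<^esub> x') = x \<otimes>\<^bsub>M\<^esub> (y \<otimes>\<^bsub>M\<^esub> (y' \<otimes>\<^bsub>M\<^esub> x'))"
          using xy x' y' by (simp add: mult_assoc mult_closed)
        also have "y \<otimes>\<^bsub>M\<^esub> (y' \<otimes>\<^bsub>M\<^esub> x') = x'"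
          using xy x' y' mult_assoc[of y y' x'] by simp
        finally show ?thesis using x' by simp
      qed
      moreover have "(y' \<otimes>\<^bsub>M\<^esub> x') \<otimes>\<^bsub>M\<^esub> (x \<otimes>\<^bsub>M\<^esub> y) = e"
      proof -
        have "(y' \<otimes>\<^bsub>M\<^esub> x') \<otimes>\<^bsub>M\<^esub> (x \<otimes>\<^bsub>M\<^esub> y) = y' \<otimes>\<^bsub>M\<^esub> (x' \<otimes>\<^bsub>M\<^esub> (x \<otimes>\<^bsub>M\<^esub> y))"
          using xy x' y' by (simp add: mult_assoc mult_closed)
        also have "x' \<otimes>\<^bsub>M\<^esub> (x \<otimes>\<^bsub>M\<^esub> y) = y"
          using xy x' y' mult_assoc[of x' x y] by simp
        finally show ?thesis using y' by simp
      qed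
      moreover have "x \<otimes>\<^bsub>M\<^esub> y \<in> carrier M" "y' \<otimes>\<^bsub>M\<^esub> x' \<in> carrier M"
        using xy x' y' by (auto intro: mult_closed)
      ultimately show ?thesis unfolding unit_group_def by blast
    qed
    show "(x \<otimes>\<^bsub>M\<^esub> y) \<otimes>\<^bsub>M\<^esub> z = x \<otimes>\<^bsub>M\<^esub> (y \<otimes>\<^bsub>M\<^esub> z)"
      if "x \<in> unit_group M e" "y \<in> unit_group M e" "z \<in> unit_group M e" for x y z
      using that by (intro mult_assoc) (auto simp: unit_group_def)
    show "e \<otimes>\<^bsub>M\<^esub> x = x" if "x \<in> unit_group M e" for x
      using that by (auto simp: unit_group_def)
    show "\<exists>y\<in>unit_group M e. y \<otimes>\<^bsub>M\<^esub> x = e" if "x \<in> unit_group M e" for x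
      using that unfolding unit_group_def by blast
  qed
  then show "semigroup_subgroup M (unit_group M e)"
    unfolding semigroup_subgroup_def using e' by (auto simp: unit_group_def)
qed

lemma semigroup_subgroupE:
  assumes "semigroup_subgroup M H"
  obtains e where "e \<in> H" "e \<in> carrier M" "e \<otimes>\<^bsub>M\<^esub> e = e" "H \<subseteq> unit_group M e"
proof -
  obtain e where H: "H \<subseteq> carrier M" and e: "e \<in> H" and g: "group (M\<lparr>carrier := H, one := e\<rparr>)"
    using assms by (auto simp: semigroup_subgroup_def)
  interpret H: group "M\<lparr>carrier := H, one := e\<rparr>" by (rule g)
  have "H \<subseteq> unit_group M e"
  proof
    fix x assume x: "x \<in> H"
    obtain y where "y \<in> H" "y \<otimes>\<^bsub>M\<^esub> x = e" using H.l_inv_ex[of x] x by auto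
    moreover have "x \<otimes>\<^bsub>M\<^esub> y = e" using H.inv_comm[of y x] calculation x by simp
    moreover have "e \<otimes>\<^bsub>M\<^esub> z = z" "z \<otimes>\<^bsub>M\<^esub> e = z" if "z \<in> H" for z
      using H.l_one[of z] H.r_one[of z] that by simp_all
    ultimately show "x \<in> unit_group M e" using x H unfolding unit_group_def by blast
  qed
  moreover have "e \<otimes>\<^bsub>M\<^esub> e = e" using H.l_one[of e] e by simp
  ultimately show thesis using that H e by blast
qed

lemma maximal_subgroup_iff:
  "maximal_subgroup M H \<longleftrightarrow> (\<exists>e\<in>carrier M. e \<otimes>\<^bsub>M\<^esub> e = e \<and> H = unit_group M e)"
proof
  assume max: "maximal_subgroup M H"
  then have "semigroup_subgroup M H" by (simp add: maximal_subgroup_def)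
  then obtain e where e: "e \<in> carrier M" "e \<otimes>\<^bsub>M\<^esub> e = e" "H \<subseteq> unit_group M e"
    by (rule semigroup_subgroupE)
  then have "\<not> H \<subset> unit_group M e"
    using max semigroup_subgroup_unit_group(1)[of e] by (simp add: maximal_subgroup_def)
  with e show "\<exists>e\<in>carrier M. e \<otimes>\<^bsub>M\<^esub> e = e \<and> H = unit_group M e"
    by (auto simp: psubset_eq)
next
  assume "\<exists>e\<in>carrier M. e \<otimes>\<^bsub>M\<^esub> e = e \<and> H = unit_group M e"
  then obtain e where e: "e \<in> carrier M" "e \<otimes>\<^bsub>M\<^esub> e = e" "H = unit_group M e" by blast
  have sg: "semigroup_subgroup M H" "e \<in> H" using semigroup_subgroup_unit_group[of e] e by simp_all
  moreover have "K = H" if K: "semigroup_subgroup M K" "H \<subseteq> K" for K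
  proof -
    obtain e' where e': "e' \<in> carrier M" "K \<subseteq> unit_group M e'" using K(1) by (rule semigroup_subgroupE)
    then obtain g where g: "g \<in> carrier M" "e \<otimes>\<^bsub>M\<^esub> g = e'" "e \<otimes>\<^bsub>M\<^esub> e' = e"
      using K(2) sg(2) by (auto simp: unit_group_def)
    \<comment> \<open>With \<open>g\<close> the inverse of \<open>e\<close> relative to
      \<open>e'\<close>: \<open>e' = e g = e e g = e e' = e\<close>.\<close>
    have "e = e'" using mult_assoc[of e e g] e g by simp
    then show ?thesis using e' e(3) K(2) by blast
  qed
  ultimately show "maximal_subgroup M H" unfolding maximal_subgroup_def psubset_eq by metis
qed

end

section \<open>Relational identities for partial bijections\<close>

lemma relcomp_converse_Id_on:
  assumes "single_valued (R\<inverse>)"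
  shows "R O R\<inverse> = Id_on (Domain R)"
proof (intro equalityI subrelI)
  fix x y assume "(x, y) \<in> R O R\<inverse>"
  then obtain w where "(x, w) \<in> R" "(y, w) \<in> R" by blast
  moreover from this have "x = y" using assms by (auto simp: single_valued_def)
  ultimately show "(x, y) \<in> Id_on (Domain R)" by (auto simp: Id_on_iff)
next
  fix x y assume "(x, y) \<in> Id_on (Domain R)"
  then show "(x, y) \<in> R O R\<inverse>" by blast
qed

lemma converse_relcomp_Id_on: "single_valued R \<Longrightarrow> R\<inverse> O R = Id_on (Range R)"
  using relcomp_converse_Id_on[of "R\<inverse>"] by simp

lemma Id_on_Domain_relcomp: "Id_on (Domain R) O R = R"
  by auto

lemma relcomp_Id_on_Range: "R O Id_on (Range R) = R"
  by auto

lemma partial_bijection_of_inverse: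
  assumes "P O Q = Id_on X" "Q O P = Id_on X" "P \<subseteq> X \<times> X" "Q \<subseteq> X \<times> X"
  shows "single_valued (P\<inverse>) \<and> Domain P = X \<and> Range P = X"
proof (intro conjI)
  show "single_valued (P\<inverse>)"
  proof (rule single_valuedI)
    fix y x x' assume "(y, x) \<in> P\<inverse>" "(y, x') \<in> P\<inverse>"
    then have xy: "(x, y) \<in> P" "(x', y) \<in> P" by auto
    then have "(y, y) \<in> Q O P" using assms(2,3) by blast
    then obtain w where w: "(y, w) \<in> Q" by blast
    then have "(x, w) \<in> P O Q" "(x', w) \<in> P O Q" using xy by blast+
    then show "x = x'" unfolding assms(1) by (auto simp: Id_on_iff)
  qed
  show "Domain P = X" using assms(1,3) by blast
  show "Range P = X" using assms(2,3) by blast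
qed

text \<open>The common ground of \<open>M_monoid\<close> and \<open>Inv_monoid\<close>: every
  injective prefix map on the words headed in \<open>B\<close> is present. All multipliers
  constructed below are built from such maps and given elements, so both monoids are treated at
  once.\<close>

locale ends_monoid = ends_semigroup A B M K
  for A B :: "'a set" and M :: "('a list \<rightharpoonup> 'a list) monoid" and K :: "('a stream \<times> 'a stream) set set" +
  assumes injective_in_K: "\<And>R. R \<in> prefix_maps_on B \<Longrightarrow> single_valued (R\<inverse>) \<Longrightarrow> R \<in> K"
    and finite_B: "finite B" and B_nonempty: "B \<noteq> {}"
begin

lemma K_on: "R \<in> K \<Longrightarrow> R \<subseteq> cyl A (BA_words A B) \<times> cyl A (BA_words A B)"
  using K_subset by (fastforce simp: prefix_maps_on_def)

lemma subset_in_K: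
  assumes "R \<in> prefix_maps A" "single_valued (R\<inverse>)"
    "Domain R \<subseteq> cyl A (BA_words A B)" "Range R \<subseteq> cyl A (BA_words A B)"
  shows "R \<in> K"
  using assms by (intro injective_in_K) (auto simp: prefix_maps_on_def)

text \<open>In general \<open>e\<close> acts not as a partial identity but as a retraction onto its
  image \<open>U\<close>. A unit is determined by its restriction to \<open>U\<close>, a bijection
  of \<open>U\<close>, which \<open>S\<close> transports to a bijection of \<open>X\<close>.\<close>

lemma unit_group_iso_G_group:
  assumes e: "e \<in> carrier M" "e \<otimes>\<^bsub>M\<^esub> e = e"
    and S: "S \<in> prefix_maps A" "single_valued (S\<inverse>)"
    and dom_S: "Domain S = Range (ends e)" and ran_S: "Range S = cyl A (BA_words A C)"
    and C: "finite C"
  shows "M\<lparr>carrier := unit_group M e\<rparr> \<cong> G_group A C"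
proof -
  interpret G: ends_semigroup A C "G_group A C" "full_bijections C"
    using C by (rule ends_semigroup_G_group)
  define E U X where "E = ends e" and "U = Range (ends e)" and "X = cyl A (BA_words A C)"
  have EE: "E O E = E" using ends_mult[OF e(1) e(1)] e(2) by (simp add: E_def)
  have E_sv: "single_valued E" using e(1) unfolding E_def by (intro K_single_valued ends_in_K)
  have EK: "E \<in> K" using e(1) by (simp add: E_def ends_in_K)
  have EU: "E O Id_on U = E" by (auto simp: U_def E_def)
  \<comment> \<open>Idempotence makes \<open>E\<close> fix every point of its image.\<close>
  have UE: "Id_on U O E = Id_on U"
  proof -
    have "(u, v) \<in> E \<longleftrightarrow> u = v" if u: "u \<in> U" for u v
    proof -
      obtain x where x: "(x, u) \<in> E" using u by (auto simp: U_def E_def)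
      then have "(x, u) \<in> E O E" using EE by simp
      then obtain y where "(x, y) \<in> E" "(y, u) \<in> E" by blast
      then have "(u, u) \<in> E" using x E_sv by (auto dest: single_valuedD)
      then show ?thesis using E_sv by (auto dest: single_valuedD)
    qed
    then show ?thesis by (auto simp: Id_on_def)
  qed
  have S_sv: "single_valued S" using S(1) by (rule prefix_maps_single_valued)
  have SS: "S O S\<inverse> = Id_on U" "S\<inverse> O S = Id_on X"
    using relcomp_converse_Id_on[OF S(2)] converse_relcomp_Id_on[OF S_sv]
    by (simp_all add: U_def X_def dom_S ran_S)
  have S': "S\<inverse> \<in> prefix_maps A" using S by (rule prefix_maps_converse)
  have US: "Id_on U O S = S" and SX: "S O Id_on X = S"
    and SU: "S\<inverse> O Id_on U = S\<inverse>" and XS: "Id_on X O S\<inverse> = S\<inverse>"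
    using Id_on_Domain_relcomp[of S] relcomp_Id_on_Range[of S]
      relcomp_Id_on_Range[of "S\<inverse>"] Id_on_Domain_relcomp[of "S\<inverse>"]
    by (simp_all add: U_def X_def dom_S ran_S)
  have SE: "S\<inverse> O E = S\<inverse>" by (metis O_assoc SU UE)
  \<comment> \<open>The same identities with a trailing factor \<open>Z\<close>, as needed for
    rewriting composites nested to the right.\<close>
  have SEZ: "S\<inverse> O (E O Z) = S\<inverse> O Z" and SSZ: "S O (S\<inverse> O Z) = Id_on U O Z"
    and SSZ': "S\<inverse> O (S O Z) = Id_on X O Z" and USZ: "Id_on U O (S O Z) = S O Z"
    and XSZ: "Id_on X O (S\<inverse> O Z) = S\<inverse> O Z" and EEZ: "E O (E O Z) = E O Z"
    and SXZ: "S O (Id_on X O Z) = S O Z" and SUZ: "S\<inverse> O (Id_on U O Z) = S\<inverse> O Z"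
    and EUZ: "E O (Id_on U O Z) = E O Z"
    for Z :: "('a stream \<times> 'a stream) set"
    unfolding O_assoc[symmetric] by (simp_all only: SE SS US XS EE SX SU EU)
  have conj_in: "R \<in> prefix_maps A \<Longrightarrow> S\<inverse> O R O S \<in> prefix_maps A" for R
    using S(1) S' by (intro prefix_maps_relcomp)
  have conj_on: "S\<inverse> O R O S \<subseteq> X \<times> X" for R
    using ran_S unfolding X_def by blast
  have unit: "ends f \<in> prefix_maps A \<and> ends f O Id_on U = ends f \<and> E O ends f = ends f \<and> ends f O E = ends f"
    if "f \<in> unit_group M e" for f
  proof -
    have f: "f \<in> carrier M" "f \<otimes>\<^bsub>M\<^esub> e = f" "e \<otimes>\<^bsub>M\<^esub> f = f" using that by (auto simp: unit_group_def)
    have "E O ends f = ends f" "ends f O E = ends f"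
      using ends_mult[of e f] ends_mult[of f e] e f by (simp_all add: E_def)
    moreover from this have "ends f O Id_on U = ends f" using EU by (metis O_assoc)
    ultimately show ?thesis using f K_prefix_maps ends_in_K by blast
  qed
  define h where "h f = word_map C (S\<inverse> O ends f O S)" for f
  have in_full: "S\<inverse> O ends f O S \<in> full_bijections C" if f: "f \<in> unit_group M e" for f
  proof -
    obtain g where g: "g \<in> carrier M" "e \<otimes>\<^bsub>M\<^esub> g = g" "g \<otimes>\<^bsub>M\<^esub> e = g" "f \<otimes>\<^bsub>M\<^esub> g = e" "g \<otimes>\<^bsub>M\<^esub> f = e"
      and f': "f \<in> carrier M" "e \<otimes>\<^bsub>M\<^esub> f = f" "f \<otimes>\<^bsub>M\<^esub> e = f"
      using f by (auto simp: unit_group_def)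
    then have g': "g \<in> unit_group M e" unfolding unit_group_def by blast
    have fg: "ends f O ends g = E" "ends g O ends f = E"
      using ends_mult[of f g] ends_mult[of g f] f' g by (simp_all add: E_def)
    have "(S\<inverse> O ends f O S) O (S\<inverse> O ends g O S) = S\<inverse> O (ends f O Id_on U) O ends g O S"
      by (simp only: O_assoc SSZ)
    also have "\<dots> = S\<inverse> O (ends f O ends g) O S" using unit[OF f] by (simp only: O_assoc)
    also have "\<dots> = Id_on X" by (simp only: fg SEZ SS)
    finally have 1: "(S\<inverse> O ends f O S) O (S\<inverse> O ends g O S) = Id_on X" .
    have "(S\<inverse> O ends g O S) O (S\<inverse> O ends f O S) = S\<inverse> O (ends g O Id_on U) O ends f O S"
      by (simp only: O_assoc SSZ)
    also have "\<dots> = S\<inverse> O (ends g O ends f) O S" using unit[OF g'] by (simp only: O_assoc)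
    also have "\<dots> = Id_on X" by (simp only: fg SEZ SS)
    finally have 2: "(S\<inverse> O ends g O S) O (S\<inverse> O ends f O S) = Id_on X" .
    have "S\<inverse> O ends f O S \<in> prefix_maps A" using unit[OF f] conj_in by blast
    then show ?thesis
      using partial_bijection_of_inverse[OF 1 2 conj_on conj_on]
      unfolding full_bijections_def prefix_maps_on_def X_def by simp
  qed
  have ends_h: "ends (h f) = S\<inverse> O ends f O S" if "f \<in> unit_group M e" for f
    using in_full[OF that] by (simp add: h_def G.ends_word_map_K)
  have h_in: "h f \<in> carrier (G_group A C)" if "f \<in> unit_group M e" for f
    using in_full[OF that] by (simp add: h_def G.word_map_in_carrier)
  have "h \<in> hom (M\<lparr>carrier := unit_group M e\<rparr>) (G_group A C)"
  proof (rule homI, simp_all add: h_in)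
    fix f g assume f: "f \<in> unit_group M e" and g: "g \<in> unit_group M e"
    then have c: "f \<in> carrier M" "g \<in> carrier M" by (auto simp: unit_group_def)
    \<comment> \<open>Both products turn into composites in reverse order, so conjugation is a
      homomorphism and not an anti-homomorphism.\<close>
    have "ends (h f \<otimes>\<^bsub>G_group A C\<^esub> h g) = (S\<inverse> O ends g O S) O (S\<inverse> O ends f O S)"
      using f g h_in by (simp add: G.ends_mult ends_h)
    also have "\<dots> = S\<inverse> O (ends g O Id_on U) O ends f O S"
      by (simp only: O_assoc SSZ)
    also have "\<dots> = S\<inverse> O ends (f \<otimes>\<^bsub>M\<^esub> g) O S"
      using unit[OF g] c by (simp only: O_assoc ends_mult)
    finally show "h (f \<otimes>\<^bsub>M\<^esub> g) = h f \<otimes>\<^bsub>G_group A C\<^esub> h g"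
      using G.word_map_ends[OF G.mult_closed[OF h_in[OF g] h_in[OF f]]] by (simp add: h_def)
  qed
  moreover have "bij_betw h (unit_group M e) (carrier (G_group A C))"
    unfolding bij_betw_def
  proof
    \<comment> \<open>A unit first retracts onto \<open>U\<close> by \<open>E\<close> and then acts
      by its restriction to \<open>U\<close>, which \<open>h f\<close> encodes.\<close>
    have recover: "ends f = E O S O ends (h f) O S\<inverse>" if f: "f \<in> unit_group M e" for f
    proof -
      have "E O S O ends (h f) O S\<inverse> = E O ends f O Id_on U"
        by (simp only: ends_h[OF f] O_assoc SSZ SS EUZ)
      then show ?thesis using unit[OF f] by simp
    qed
    show "inj_on h (unit_group M e)"
    proof (rule inj_onI)
      fix f g assume fg: "f \<in> unit_group M e" "g \<in> unit_group M e" "h f = h g"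
      then have "ends f = ends g" using recover by metis
      moreover have "f \<in> carrier M" "g \<in> carrier M" using fg by (auto simp: unit_group_def)
      ultimately show "f = g" using ends_eq_iff by blast
    qed
    show "h ` unit_group M e = carrier (G_group A C)"
    proof (intro equalityI subsetI)
      show "x \<in> carrier (G_group A C)" if "x \<in> h ` unit_group M e" for x using that h_in by blast
      fix a assume a: "a \<in> carrier (G_group A C)"
      define R where "R = ends a"
      have R: "R \<in> full_bijections C" using a by (simp add: R_def G.ends_in_K)
      then have R_pm: "R \<in> prefix_maps A" "single_valued (R\<inverse>)" "single_valued R"
        by (auto simp: full_bijections_def prefix_maps_on_def intro: prefix_maps_single_valued)
      have R_dom: "Domain R = X" "Range R = X" using R by (auto simp: full_bijections_def X_def)
      have R_pm': "R\<inverse> \<in> prefix_maps A" using R_pm(1,2) by (rule prefix_maps_converse)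
      have RR: "R O R\<inverse> = Id_on X" "R\<inverse> O R = Id_on X"
        using relcomp_converse_Id_on[OF R_pm(2)] converse_relcomp_Id_on[OF R_pm(3)]
        by (simp_all add: R_dom)
      have XR: "Id_on X O R = R" "R O Id_on X = R" "Id_on X O R\<inverse> = R\<inverse>" "R\<inverse> O Id_on X = R\<inverse>"
        using Id_on_Domain_relcomp[of R] relcomp_Id_on_Range[of R]
          relcomp_Id_on_Range[of "R\<inverse>"] Id_on_Domain_relcomp[of "R\<inverse>"]
        by (simp_all add: R_dom)
      have XRZ: "R O (Id_on X O Z) = R O Z" "R\<inverse> O (Id_on X O Z) = R\<inverse> O Z"
        "R O (R\<inverse> O Z) = Id_on X O Z" "R\<inverse> O (R O Z) = Id_on X O Z"
        for Z :: "('a stream \<times> 'a stream) set"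
        unfolding O_assoc[symmetric] by (simp_all only: RR XR)
      have U_sub: "U \<subseteq> cyl A (BA_words A B)" using K_on[OF EK] by (auto simp: U_def E_def)
      \<comment> \<open>\<open>E\<close> need not be injective, so only the factor after it comes
        from \<open>subset_in_K\<close>. The leading \<open>E\<close> extends the domain from
        \<open>U\<close> to that of \<open>e\<close>.\<close>
      have lift: "E O S O Q O S\<inverse> \<in> K"
        if "Q \<in> prefix_maps A" "single_valued (Q\<inverse>)" for Q
      proof -
        have "S O Q O S\<inverse> \<in> K"
        proof (rule subset_in_K)
          show "S O Q O S\<inverse> \<in> prefix_maps A" using that S S' by (intro prefix_maps_relcomp)
          show "single_valued ((S O Q O S\<inverse>)\<inverse>)"
            using that S S_sv by (intro relcomp_inj) simp_all
          show "Domain (S O Q O S\<inverse>) \<subseteq> cyl A (BA_words A B)"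
            "Range (S O Q O S\<inverse>) \<subseteq> cyl A (BA_words A B)"
            using dom_S U_sub unfolding U_def by blast+
        qed
        with EK show ?thesis by (rule K_relcomp)
      qed
      define f where "f = word_map B (E O S O R O S\<inverse>)"
      define g where "g = word_map B (E O S O R\<inverse> O S\<inverse>)"
      have ends_f: "ends f = E O S O R O S\<inverse>" and f: "f \<in> carrier M"
        using lift[OF R_pm(1,2)] by (simp_all add: f_def ends_word_map_K word_map_in_carrier)
      have ends_g: "ends g = E O S O R\<inverse> O S\<inverse>" and g: "g \<in> carrier M"
        using lift[OF R_pm'] R_pm(3) by (simp_all add: g_def ends_word_map_K word_map_in_carrier)
      note rels = O_assoc EE SE SEZ SS SSZ SSZ' US USZ XS XSZ EEZ SX SXZ SU SUZ EU EUZ RR XR XRZ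
      have f': "f \<in> unit_group M e"
        unfolding unit_group_def mem_Collect_eq
      proof (intro conjI bexI[of _ g])
        show "e \<otimes>\<^bsub>M\<^esub> f = f" "f \<otimes>\<^bsub>M\<^esub> e = f" "e \<otimes>\<^bsub>M\<^esub> g = g" "g \<otimes>\<^bsub>M\<^esub> e = g"
          "f \<otimes>\<^bsub>M\<^esub> g = e" "g \<otimes>\<^bsub>M\<^esub> f = e"
          by (subst ends_eq_iff[symmetric],
              simp_all only: f g e mult_closed ends_mult ends_f ends_g E_def[symmetric] rels)+
      qed (fact f g)+
      have "h f = word_map C (S\<inverse> O (E O S O R O S\<inverse>) O S)" by (simp add: h_def ends_f)
      also have "S\<inverse> O (E O S O R O S\<inverse>) O S = R" by (simp only: rels)
      also have "word_map C R = a" using a by (simp add: R_def G.word_map_ends)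
      finally show "a \<in> h ` unit_group M e" using f' by blast
    qed
  qed
  ultimately show ?thesis by (intro is_isoI[of h]) (simp add: iso_def)
qed

end

section \<open>Green's relations\<close>

context ends_monoid
begin

lemma Range_ends_subset: "u \<in> carrier M \<Longrightarrow> Range (ends u) \<subseteq> cyl A (BA_words A B)"
  using K_on[OF ends_in_K] by blast

text \<open>If the image of \<open>u\<close> lies in that of \<open>v\<close>, a section
  \<open>S\<close> of \<open>v\<close> pulls it back: \<open>u\<close> followed by \<open>S\<close>
  is the right factor.\<close>

lemma green_leR_iff:
  assumes u: "u \<in> carrier M" and v: "v \<in> carrier M"
  shows "green_leR M u v \<longleftrightarrow> Range (ends u) \<subseteq> Range (ends v)"
proof
  assume "green_leR M u v"
  then obtain x where "x \<in> carrier M" "u = v \<otimes>\<^bsub>M\<^esub> x" by (auto simp: green_leR_def)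
  then have "ends u = ends x O ends v" using v by (simp add: ends_mult)
  then show "Range (ends u) \<subseteq> Range (ends v)" by blast
next
  assume sub: "Range (ends u) \<subseteq> Range (ends v)"
  obtain S where S: "S \<in> prefix_maps A" "S O ends v = Id_on (Range (ends v))"
    "Range S \<subseteq> Domain (ends v)" "Domain S = Range (ends v)" "single_valued (S\<inverse>)"
    using prefix_maps_section[OF K_prefix_maps[OF ends_in_K[OF v]]] by blast
  have "S \<in> K"
    using S K_on[OF ends_in_K[OF v]] by (intro subset_in_K) blast+
  then have K: "ends u O S \<in> K" using u by (intro K_relcomp ends_in_K)
  have "ends (v \<otimes>\<^bsub>M\<^esub> word_map B (ends u O S)) = ends u O S O ends v"
    using K v by (simp add: ends_mult word_map_in_carrier ends_word_map_K O_assoc)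
  also have "\<dots> = ends u" using sub unfolding S(2) by (auto simp: subset_iff Range_iff)
  finally have "u = v \<otimes>\<^bsub>M\<^esub> word_map B (ends u O S)"
    using K u v by (simp add: ends_eq_iff mult_closed word_map_in_carrier)
  then show "green_leR M u v"
    unfolding green_leR_def using K word_map_in_carrier by blast
qed

lemma green_eqR_iff:
  "u \<in> carrier M \<Longrightarrow> v \<in> carrier M \<Longrightarrow> green_eqR M u v \<longleftrightarrow> Range (ends u) = Range (ends v)"
  by (auto simp: green_eqR_def green_leR_iff)

lemma green_eqL_bijection:
  assumes u: "u \<in> carrier M" and v: "v \<in> carrier M" and L: "green_eqL M u v"
  shows "\<exists>S\<in>prefix_maps A. single_valued (S\<inverse>) \<and> Domain S = Range (ends u) \<and> Range S = Range (ends v)"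
proof -
  obtain x y where x: "x \<in> carrier M" "u = x \<otimes>\<^bsub>M\<^esub> v" and y: "y \<in> carrier M" "v = y \<otimes>\<^bsub>M\<^esub> u"
    using L by (auto simp: green_eqL_def green_leL_def)
  define U where "U = Range (ends u)"
  have eu: "ends u = ends v O ends x" using ends_mult[OF v x(1)] x(2) by simp
  have ev: "ends v = ends u O ends y" using ends_mult[OF u y(1)] y(2) by simp
  have sv: "single_valued (ends u)" "single_valued (ends y)" "single_valued (ends x)"
    using u x(1) y(1) by (auto intro: K_single_valued ends_in_K)
  \<comment> \<open>From \<open>u = x y u\<close>: a point of the image of \<open>u\<close> returns
    to itself under \<open>y\<close> and then \<open>x\<close>. Hence \<open>y\<close>, restricted
    to that image, is the required bijection.\<close>
  have *: "\<exists>c. (a, c) \<in> ends y \<and> (c, a) \<in> ends x" if a: "a \<in> U" for a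
  proof -
    obtain b where b: "(b, a) \<in> ends u" using a by (auto simp: U_def)
    then obtain a' c where "(b, a') \<in> ends u" "(a', c) \<in> ends y" "(c, a) \<in> ends x"
      using eu ev by blast
    moreover from this have "a' = a" using b sv(1) by (auto dest: single_valuedD)
    ultimately show ?thesis by blast
  qed
  define S where "S = Id_on U O ends y"
  have mem: "(a, c) \<in> S \<longleftrightarrow> a \<in> U \<and> (a, c) \<in> ends y" for a c by (auto simp: S_def)
  obtain P where P: "finite P" "P \<subseteq> BA_words A UNIV" "U = cyl A P"
    using prefix_maps_Range[OF K_prefix_maps[OF ends_in_K[OF u]]] by (auto simp: U_def)
  have "Id_on U \<in> prefix_maps A" unfolding P(3) using P(1,2) by (rule Id_on_in_prefix_maps)
  then have "S \<in> prefix_maps A"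
    unfolding S_def using K_prefix_maps[OF ends_in_K[OF y(1)]] by (rule prefix_maps_relcomp)
  moreover have "single_valued (S\<inverse>)"
  proof (rule single_valuedI)
    fix c a a' assume "(c, a) \<in> S\<inverse>" "(c, a') \<in> S\<inverse>"
    then have "(c, a) \<in> ends x" "(c, a') \<in> ends x"
      using * sv(2) mem by (metis converse_iff single_valuedD)+
    then show "a = a'" using sv(3) by (auto dest: single_valuedD)
  qed
  moreover have "Domain S = U" using * mem by (metis Domain.DomainI DomainE subsetI subset_antisym)
  moreover have "Range S = Range (ends v)"
    unfolding ev S_def U_def by blast
  ultimately show ?thesis unfolding U_def by blast
qed

text \<open>Conversely, \<open>v\<close> followed by \<open>S\<inverse>\<close> is the intermediate
  element \<open>t\<close>: its image is that of \<open>u\<close>, and left multiplication by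
  \<open>S\<close> and \<open>S\<inverse>\<close> passes between \<open>t\<close> and
  \<open>v\<close>.\<close>

lemma green_D_iff:
  assumes u: "u \<in> carrier M" and v: "v \<in> carrier M"
  shows "(u, v) \<in> green_D M \<longleftrightarrow>
    (\<exists>S\<in>prefix_maps A. single_valued (S\<inverse>) \<and> Domain S = Range (ends u) \<and> Range S = Range (ends v))"
proof
  assume "(u, v) \<in> green_D M"
  then obtain t where "t \<in> carrier M" "green_eqR M u t" "green_eqL M t v" by (auto simp: green_D_def)
  then show "\<exists>S\<in>prefix_maps A. single_valued (S\<inverse>) \<and> Domain S = Range (ends u) \<and> Range S = Range (ends v)"
    using green_eqL_bijection[of t v] green_eqR_iff[OF u, of t] v by simp
next
  assume "\<exists>S\<in>prefix_maps A. single_valued (S\<inverse>) \<and> Domain S = Range (ends u) \<and> Range S = Range (ends v)"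
  then obtain S where S: "S \<in> prefix_maps A" "single_valued (S\<inverse>)" "Domain S = Range (ends u)"
    "Range S = Range (ends v)" by blast
  have S_sv: "single_valued S" using S(1) by (rule prefix_maps_single_valued)
  have SK: "S \<in> K"
    using S Range_ends_subset u v by (intro subset_in_K) simp_all
  have S'K: "S\<inverse> \<in> K"
    using S S_sv Range_ends_subset u v prefix_maps_converse by (intro subset_in_K) simp_all
  have tK: "ends v O S\<inverse> \<in> K" using v S'K by (intro K_relcomp ends_in_K)
  define t where "t = word_map B (ends v O S\<inverse>)"
  have t: "t \<in> carrier M" "ends t = ends v O S\<inverse>"
    using tK by (simp_all add: t_def word_map_in_carrier ends_word_map_K)
  have "Range (ends t) = Range (ends u)" unfolding t(2) S(3)[symmetric] using S(4) by blast
  then have "green_eqR M u t" using u t by (simp add: green_eqR_iff)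
  moreover have "green_eqL M t v"
    unfolding green_eqL_def green_leL_def
  proof (intro conjI bexI)
    show in_M: "word_map B (S\<inverse>) \<in> carrier M" "word_map B S \<in> carrier M"
      using SK S'K by (simp_all add: word_map_in_carrier)
    have "ends t = ends (word_map B (S\<inverse>) \<otimes>\<^bsub>M\<^esub> v)"
      using in_M v S'K t by (simp add: ends_mult ends_word_map_K)
    then show "t = word_map B (S\<inverse>) \<otimes>\<^bsub>M\<^esub> v"
      using in_M v t by (simp add: ends_eq_iff mult_closed)
    have "ends (word_map B S \<otimes>\<^bsub>M\<^esub> t) = ends v O S\<inverse> O S"
      using in_M t SK by (simp add: ends_mult ends_word_map_K O_assoc)
    also have "\<dots> = ends v"
      using converse_relcomp_Id_on[OF S_sv] relcomp_Id_on_Range[of "ends v"] by (simp add: S(4))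
    finally show "v = word_map B S \<otimes>\<^bsub>M\<^esub> t"
      using in_M v t by (simp add: ends_eq_iff mult_closed)
  qed
  ultimately show "(u, v) \<in> green_D M" using u v t by (auto simp: green_D_def)
qed

lemma carrier_rihom: "\<phi> \<in> carrier M \<Longrightarrow> rihom A B \<phi>"
  using K_subset rihom_word_map by (auto simp: carrier_M)

lemma imC_carrier:
  assumes "\<phi> \<in> carrier M"
  shows "finite (imC A B \<phi>)" "prefix_code A UNIV (imC A B \<phi>)" "Range (ends \<phi>) = cyl A (imC A B \<phi>)"
    "\<phi> \<noteq> Map.empty \<Longrightarrow> imC A B \<phi> \<noteq> {}"
proof -
  note imC = imC_rihom[OF carrier_rihom[OF assms]]
  show "finite (imC A B \<phi>)" "Range (ends \<phi>) = cyl A (imC A B \<phi>)" using imC by simp_all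
  show "prefix_code A UNIV (imC A B \<phi>)"
    using imC(2) BA_words_mono[of B UNIV A] unfolding prefix_code_def by blast
  show "imC A B \<phi> \<noteq> {}" if "\<phi> \<noteq> Map.empty"
  proof
    assume "imC A B \<phi> = {}"
    then have "Range (ends \<phi>) = {}" using imC(3) by (simp add: cyl_def)
    then have "ends \<phi> = {}" by (simp add: Range_empty_iff)
    then show False using that assms by (simp add: ends_eq_empty_iff)
  qed
qed

text \<open>The empty map has an empty image code, of size \<open>0\<close>, which is congruent to
  \<open>card A - 1\<close>; so it has to be excluded explicitly.\<close>

lemma green_D_iff_card_cong:
  assumes u: "u \<in> carrier M" "u \<noteq> Map.empty" and v: "v \<in> carrier M"
  shows "(u, v) \<in> green_D M \<longleftrightarrow>
    v \<noteq> Map.empty \<and> [card (imC A B u) = card (imC A B v)] (mod (card A - 1))"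
proof
  assume "(u, v) \<in> green_D M"
  then obtain S where S: "S \<in> prefix_maps A" "single_valued (S\<inverse>)" "Domain S = Range (ends u)"
    "Range S = Range (ends v)" using green_D_iff u v by blast
  have "ends u \<noteq> {}" using u by (simp add: ends_eq_empty_iff)
  then have "ends v \<noteq> {}" using S(3,4) by (metis Domain_empty_iff Range_empty_iff)
  then have "v \<noteq> Map.empty" using v by (simp add: ends_eq_empty_iff)
  then show "v \<noteq> Map.empty \<and> [card (imC A B u) = card (imC A B v)] (mod (card A - 1))"
    using prefix_maps_bijection_card_cong[OF S(1,2)] S(3,4) imC_carrier[OF u(1)] imC_carrier[OF v]
    by simp
next
  assume "v \<noteq> Map.empty \<and> [card (imC A B u) = card (imC A B v)] (mod (card A - 1))"
  then show "(u, v) \<in> green_D M"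
    unfolding green_D_iff[OF u(1) v] imC_carrier(3)[OF u(1)] imC_carrier(3)[OF v]
    using imC_carrier[OF u(1)] imC_carrier[OF v] u(2)
    by (intro prefix_maps_bijection_of_card_cong) simp_all
qed

section \<open>The classes \<open>D_set\<close> and their idempotents\<close>

lemma D_set_eq_green_D_Image:
  assumes "u \<in> D_set A B M j"
  shows "D_set A B M j = green_D M `` {u}"
proof -
  have u: "u \<in> carrier M" "u \<noteq> Map.empty" "[card (imC A B u) = j] (mod (card A - 1))"
    using assms by (auto simp: D_set_def)
  have "v \<in> D_set A B M j \<longleftrightarrow> (u, v) \<in> green_D M" if "v \<in> carrier M" for v
    using green_D_iff_card_cong[OF u(1,2) that] u(3) that
    by (auto simp: D_set_def intro: cong_trans cong_sym)
  moreover have "v \<in> carrier M" if "(u, v) \<in> green_D M" for v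
    using that by (simp add: green_D_def)
  ultimately show ?thesis by (auto simp: D_set_def)
qed

lemma in_D_set_of_Range_eq:
  assumes "u \<in> D_set A B M j" "v \<in> carrier M" "Range (ends u) = Range (ends v)"
  shows "v \<in> D_set A B M j"
proof -
  have u: "u \<in> carrier M" using assms(1) by (auto simp: D_set_def)
  obtain P where P: "finite P" "P \<subseteq> BA_words A UNIV" "Range (ends u) = cyl A P"
    using prefix_maps_Range[OF K_prefix_maps[OF ends_in_K[OF u]]] by auto
  have "Id_on (cyl A P) \<in> prefix_maps A" using P(1,2) by (rule Id_on_in_prefix_maps)
  then have "(u, v) \<in> green_D M"
    unfolding green_D_iff[OF u assms(2)] using P(3) assms(3)
    by (intro bexI[of _ "Id_on (cyl A P)"]) simp_all
  then show ?thesis using D_set_eq_green_D_Image[OF assms(1)] by blast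
qed

lemma D_set_idempotent:
  assumes "1 \<le> j" "j \<le> card A"
  shows "\<exists>e\<in>D_set A B M j. e \<otimes>\<^bsub>M\<^esub> e = e"
proof -
  obtain b where b: "b \<in> B" using B_nonempty by blast
  obtain A' where A': "A' \<subseteq> A" "card A' = j"
    using assms(2) by (meson obtain_subset_with_card_n)
  \<comment> \<open>Words of length two, because \<open>B\<close> may have fewer than
    \<open>j\<close> letters.\<close>
  define P where "P = (\<lambda>a. [b, a]) ` A'"
  have P: "finite P" "P \<subseteq> BA_words A B" "P \<noteq> {}"
    using A' b assms(1) finite_A finite_subset by (auto simp: P_def BA_words_def)
  have code: "prefix_code A UNIV P"
    using P(2) BA_words_mono[of B UNIV A] by (auto simp: prefix_code_def P_def dest: prefix_length_less)
  have "card P = j" unfolding P_def A'(2)[symmetric] by (rule card_image) (simp add: inj_on_def)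
  have "P \<subseteq> BA_words A UNIV" using P(2) BA_words_mono[of B UNIV A] by blast
  then have "Id_on (cyl A P) \<in> prefix_maps A" by (rule Id_on_in_prefix_maps[OF P(1)])
  then have K: "Id_on (cyl A P) \<in> K"
    using cyl_mono[OF P(2)] by (intro subset_in_K) auto
  define e where "e = word_map B (Id_on (cyl A P))"
  have e: "e \<in> carrier M" "ends e = Id_on (cyl A P)"
    using K by (simp_all add: e_def word_map_in_carrier ends_word_map_K)
  have "ends (e \<otimes>\<^bsub>M\<^esub> e) = ends e" using e by (auto simp: ends_mult)
  then have "e \<otimes>\<^bsub>M\<^esub> e = e" using ends_eq_iff[OF mult_closed[OF e(1,1)] e(1)] by blast
  moreover have "cyl A P \<noteq> {}"
    using P(3) streams_nonempty cylI by blast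
  then have "ends e \<noteq> {}" unfolding e(2) by auto
  then have "e \<noteq> Map.empty" using e(1) by (simp add: ends_eq_empty_iff)
  \<comment> \<open>The image code of the maximally extended \<open>e\<close> may differ from
    \<open>P\<close>, but having the same cylinder it has a congruent size.\<close>
  moreover have "cyl A (imC A B e) = cyl A P" using imC_carrier(3)[OF e(1)] e(2) by simp
  then have "[card (imC A B e) = j] (mod (card A - 1))"
    using card_cong_of_cyl_eq[OF imC_carrier(2,1)[OF e(1)] code P(1)] \<open>card P = j\<close> by simp
  ultimately show ?thesis using e(1) by (auto simp: D_set_def)
qed

lemma unit_group_Range:
  assumes "e \<in> carrier M" "f \<in> unit_group M e"
  shows "Range (ends f) = Range (ends e)"
proof -
  obtain g where g: "g \<in> carrier M" "f \<otimes>\<^bsub>M\<^esub> g = e" and f: "f \<in> carrier M" "e \<otimes>\<^bsub>M\<^esub> f = f"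
    using assms(2) by (auto simp: unit_group_def)
  have "ends e = ends g O ends f" "ends f = ends f O ends e"
    using ends_mult[OF g(1) f(1)] ends_mult[OF f(1) assms(1)] g f by simp_all
  moreover have "Range (ends g O ends f) \<subseteq> Range (ends f)" "Range (ends f O ends e) \<subseteq> Range (ends e)"
    by blast+
  ultimately show ?thesis by (metis subset_antisym)
qed

lemma unit_group_in_D_set:
  assumes "e \<in> D_set A B M j"
  shows "unit_group M e \<subseteq> D_set A B M j"
proof
  fix f assume f: "f \<in> unit_group M e"
  then have "f \<in> carrier M" by (simp add: unit_group_def)
  moreover have "e \<in> carrier M" using assms by (simp add: D_set_def)
  ultimately show "f \<in> D_set A B M j"
    using in_D_set_of_Range_eq[OF assms] unit_group_Range f by simp
qed

lemma unit_group_iso_of_D_set: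
  assumes e: "e \<in> D_set A B M j" "e \<otimes>\<^bsub>M\<^esub> e = e" and C: "finite C" "card C = j" "1 \<le> j"
  shows "M\<lparr>carrier := unit_group M e\<rparr> \<cong> G_group A C"
proof -
  have e': "e \<in> carrier M" "e \<noteq> Map.empty" "[card (imC A B e) = j] (mod (card A - 1))"
    using e(1) by (auto simp: D_set_def)
  \<comment> \<open>The one-letter words over \<open>C\<close>: a code of size \<open>j\<close>
    whose cylinder is everything headed in \<open>C\<close>.\<close>
  define Q where "Q = (\<lambda>c. [c]) ` C"
  have Q: "prefix_code A UNIV Q" "finite Q" "Q \<noteq> {}" "card Q = j"
  proof -
    show "prefix_code A UNIV Q"
      by (auto simp: Q_def prefix_code_def BA_words_def dest: prefix_length_less)
    show "card Q = j" unfolding Q_def C(2)[symmetric] by (rule card_image) (simp add: inj_on_def)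
    show "finite Q" "Q \<noteq> {}" using C by (auto simp: Q_def)
  qed
  have cQ: "cyl A Q = cyl A (BA_words A C)"
  proof (intro equalityI subsetI)
    show "s \<in> cyl A (BA_words A C)" if "s \<in> cyl A Q" for s
      using that unfolding cyl_BA_words_iff by (auto simp: Q_def cyl_def)
    fix s assume "s \<in> cyl A (BA_words A C)"
    then show "s \<in> cyl A Q" using cylI[of "[shd s]" Q "stl s" A] by (simp add: cyl_BA_words_iff Q_def)
  qed
  obtain S where "S \<in> prefix_maps A" "single_valued (S\<inverse>)" "Domain S = Range (ends e)"
    "Range S = cyl A (BA_words A C)"
    using prefix_maps_bijection_of_card_cong[OF imC_carrier(2,1)[OF e'(1)] imC_carrier(4)[OF e'(1,2)] Q(1,2,3)]
      e'(3) Q(4) cQ imC_carrier(3)[OF e'(1)] by auto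
  then show ?thesis using e'(1) e(2) C(1) by (intro unit_group_iso_G_group)
qed

lemma maximal_subgroups_of_D_classes:
  fixes C :: "nat \<Rightarrow> 'a set"
  assumes C: "\<And>j. j \<in> {1..card A - 1} \<Longrightarrow> finite (C j) \<and> card (C j) = j"
  shows "(\<forall>H. maximal_subgroup M H \<and> H \<noteq> {Map.empty} \<longrightarrow>
         (\<exists>j \<in> {1..card A - 1}. M\<lparr>carrier := H\<rparr> \<cong> G_group A (C j))) \<and>
    (\<forall>j \<in> {1..card A - 1}.
         D_set A B M j \<in> D_classes M \<and>
         (\<exists>H. maximal_subgroup M H \<and> H \<subseteq> D_set A B M j) \<and>
         (\<forall>H. maximal_subgroup M H \<and> H \<subseteq> D_set A B M j \<longrightarrow>
              M\<lparr>carrier := H\<rparr> \<cong> G_group A (C j)))"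
proof (intro conjI allI impI ballI; (elim conjE)?)
  fix H assume "maximal_subgroup M H" and H: "H \<noteq> {Map.empty}"
  then obtain e where e: "e \<in> carrier M" "e \<otimes>\<^bsub>M\<^esub> e = e" "H = unit_group M e"
    by (auto simp: maximal_subgroup_iff)
  have ne: "e \<noteq> Map.empty"
  proof
    assume e0: "e = Map.empty"
    \<comment> \<open>All units share the image of \<open>e\<close>, so the unit group of the zero
      element is trivial.\<close>
    have "f = Map.empty" if "f \<in> H" for f
    proof -
      have "f \<in> carrier M" using that e(3) by (simp add: unit_group_def)
      moreover have "Range (ends f) = {}"
        using unit_group_Range[OF e(1)] that e e0 ends_eq_empty_iff[OF e(1)] by simp
      then have "ends f = {}" by (simp add: Range_empty_iff)
      ultimately show ?thesis by (simp add: ends_eq_empty_iff)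
    qed
    moreover have "e \<in> H" using semigroup_subgroup_unit_group(2)[OF e(1,2)] e(3) by simp
    ultimately show False using H e0 by blast
  qed
  define n where "n = card (imC A B e)"
  \<comment> \<open>Shifting by one picks the representative in \<open>1\<close> to
    \<open>card A - 1\<close>, with \<open>card A - 1\<close> in place of \<open>0\<close>.\<close>
  define j where "j = (n - 1) mod (card A - 1) + 1"
  have n: "n \<ge> 1"
    using imC_carrier(1)[OF e(1)] imC_carrier(4)[OF e(1) ne] by (simp add: n_def Suc_le_eq card_gt_0_iff)
  have j: "j \<in> {1..card A - 1}" using card_A by (simp add: j_def Suc_le_eq)
  have "[n - 1 + 1 = j] (mod (card A - 1))"
    unfolding j_def by (intro cong_add) (simp_all add: cong_def)
  then have "e \<in> D_set A B M j" using e(1) ne n by (simp add: D_set_def n_def)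
  then have "M\<lparr>carrier := unit_group M e\<rparr> \<cong> G_group A (C j)"
    using e(2) C[OF j] j by (intro unit_group_iso_of_D_set) auto
  then show "\<exists>j\<in>{1..card A - 1}. M\<lparr>carrier := H\<rparr> \<cong> G_group A (C j)" using j e(3) by blast
next
  fix j assume j: "j \<in> {1..card A - 1}"
  then have "1 \<le> j" "j \<le> card A" by auto
  then obtain e where e: "e \<in> D_set A B M j" "e \<otimes>\<^bsub>M\<^esub> e = e"
    using D_set_idempotent by blast
  have "e \<in> carrier M" using e(1) by (simp add: D_set_def)
  then show "D_set A B M j \<in> D_classes M"
    unfolding D_classes_def D_set_eq_green_D_Image[OF e(1)] by (rule quotientI)
  show "\<exists>H. maximal_subgroup M H \<and> H \<subseteq> D_set A B M j"
    using e \<open>e \<in> carrier M\<close> unit_group_in_D_set by (auto simp: maximal_subgroup_iff)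
next
  fix j H assume j: "j \<in> {1..card A - 1}" and "maximal_subgroup M H" and H: "H \<subseteq> D_set A B M j"
  then obtain e where e: "e \<in> carrier M" "e \<otimes>\<^bsub>M\<^esub> e = e" "H = unit_group M e"
    by (auto simp: maximal_subgroup_iff)
  then have "e \<in> D_set A B M j" using H semigroup_subgroup_unit_group(2)[OF e(1,2)] by blast
  then show "M\<lparr>carrier := H\<rparr> \<cong> G_group A (C j)"
    unfolding e(3) using e(2) C[OF j] j by (intro unit_group_iso_of_D_set) auto
qed

end

text \<open>Both monoids are instances of \<open>ends_monoid\<close>, one with all prefix maps on
  the words headed in \<open>B\<close> and the other with the injective ones.\<close>

theorem proposition3p5:
  fixes A B :: "'a set" and C :: "nat \<Rightarrow> 'a set" and k i :: nat
  assumes "finite A" and "card A = k" and "2 \<le> k"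
    and "finite B" and "card B = i" and "1 \<le> i" and "i \<le> k - 1"
    and "\<And>j. j \<in> {1..k - 1} \<Longrightarrow> finite (C j) \<and> card (C j) = j"
  shows "\<forall>M \<in> {M_monoid A B, Inv_monoid A B}.
    (\<forall>H. maximal_subgroup M H \<and> H \<noteq> {Map.empty} \<longrightarrow>
         (\<exists>j \<in> {1..k - 1}. M\<lparr>carrier := H\<rparr> \<cong> G_group A (C j))) \<and>
    (\<forall>j \<in> {1..k - 1}.
         D_set A B M j \<in> D_classes M \<and>
         (\<exists>H. maximal_subgroup M H \<and> H \<subseteq> D_set A B M j) \<and>
         (\<forall>H. maximal_subgroup M H \<and> H \<subseteq> D_set A B M j \<longrightarrow>
              M\<lparr>carrier := H\<rparr> \<cong> G_group A (C j)))"
proof -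
  interpret alphabet A using assms(1-3) by unfold_locales simp_all
  have B: "finite B" "B \<noteq> {}" using assms(4-6) by auto
  interpret M: ends_monoid A B "M_monoid A B" "prefix_maps_on B"
    using B by unfold_locales simp_all
  interpret I: ends_monoid A B "Inv_monoid A B" "{R \<in> prefix_maps_on B. single_valued (R\<inverse>)}"
    using B by unfold_locales simp_all
  have C: "finite (C j) \<and> card (C j) = j" if "j \<in> {1..card A - 1}" for j
    using assms(2,8) that by simp
  show ?thesis
    using M.maximal_subgroups_of_D_classes[of C, OF C] I.maximal_subgroups_of_D_classes[of C, OF C]
    unfolding assms(2) by blast
qed

end
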